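(* Let $f\in\mathbb G(\Omega_{\mathbb X})$ with $\|f\|_\infty$ finite, and let $\nu^f:\Omega\to\mathbb M^{\mathbb P}(\mathbb R)$ be the Young measure that satisfies $${}^\circ\langle{}^*\Psi(f),{}^*\varphi\rangle=\int_\Omega\Big(\int_{\mathbb R}\Psi\,d\nu^f_x\Big)\varphi(x)\,dx\qquad\text{for all }\Psi\in C^0_b(\mathbb R),\ \varphi\in C^0_c(\Omega).$$ Then $[f]\in L^\infty(\Omega)$ and the following equality holds for a.e. $x\in\Omega$: $$[f](x)=\int_{\mathbb R}\tau\,d\nu^f_x(\tau).$$ Moreover: 1. if $\{f_n\}_{n\in\mathbb N}$ is a sequence of $L^\infty$ functions that converges weakly-$\star$ to $\nu^f$, in the sense that $\lim_{n\to\infty}\int_\Omega\Psi(f_n(x))\varphi(x)\,dx=\int_\Omega\big(\int_{\mathbb R}\Psi\,d\nu^f_x\big)\varphi(x)\,dx$ for all $\Psi\in C^0_b(\mathbb R)$ and all $\varphi\in L^1(\Omega)$, then $f_n\stackrel{\star}{\rightharpoonup}[f]$ in $L^\infty$; 2. if $\nu^f$ is Dirac, then $\nu^f_x$ is the Dirac measure centred at $[f](x)$ for a.e. $x\in\Omega$.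
   Context: Work in a $|\mathscr D'(\Omega)|$-saturated nonstandard extension $A\mapsto{}^*A$ of the standard universe; ${}^\circ x$ is the standard part of a finite $x$. Fix an infinite $N_0\in{}^*\mathbb N$, let $N=N_0!$, $\varepsilon=1/N$, and $\mathbb X=\{n\varepsilon: n\in{}^*\mathbb Z,\ -N^2\le n\le N^2\}$. Let $\Omega\subseteq\mathbb R^k$ be open and $\Omega_{\mathbb X}={}^*\Omega\cap\mathbb X^k$. $\mathbb G(\Omega_{\mathbb X})$ is the set of internal functions $\Omega_{\mathbb X}\to{}^*\mathbb R$. $\langle f,g\rangle=\varepsilon^k\sum_{x\in\Omega_{\mathbb X}}f(x)g(x)$ (with ${}^*\varphi$ restricted to $\Omega_{\mathbb X}$), and $\|f\|_\infty=\max_{x\in\Omega_{\mathbb X}}|f(x)|$. $C^0_b(\mathbb R)$ denotes the continuous bounded functions $\Psi$ with $\lim_{|x|\to\infty}\Psi(x)=0$. $C^0_c(\Omega)$ denotes continuous functions with compact support in $\Omega$. $\mathbb M^{\mathbb P}(\mathbb R)$ is the set of Radon probability measures on $\mathbb R$. A Young measure is a measurable map $\nu:\Omega\to\mathbb M^{\mathbb P}(\mathbb R)$, $x\mapsto\nu_x$; it is Dirac if its values are Dirac measures. It is known that for every $f$ with $\|f\|_\infty$ finite a $\nu^f$ as in the claim exists. For $f$ with $\|f\|_\infty$ finite, $[f]$ denotes the distribution $\varphi\mapsto{}^\circ\langle f,{}^*\varphi\rangle$, $\varphi\in\mathscr D(\Omega)$ (smooth functions with compact support in $\Omega$). "$[f]\in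 L^\infty(\Omega)$" means that this distribution is given by integration against an $L^\infty(\Omega)$ function, also denoted $[f]$.
   Formalization: In item 1 the sequence f_n is also assumed bounded in L^∞ uniformly in n; without this the claim fails (Ω=(0,1), f=0, f_n = n·1_(0,1/n)), and every weakly-star convergent sequence in L^∞ is bounded. *)

theory Defs
  imports "HOL-Probability.Probability" "HOL-Library.Equipollence"
begin

section \<open>Nonstandard extensions\<close>

text \<open>
  HOL has no type containing all finite levels of the superstructure over the reals, so the standard
  universe is a type that has the objects needed here as elements: real numbers, points of the
  \<open>k\<close>-dimensional space, all subsets of the product of that space with the reals (in
  particular the graphs of functions defined on a set of points), and, through the constructor
  \<open>Ob\<close>, any further standard objects, their type \<open>'e\<close> being arbitrary.
\<close>

datatype ('k::finite, 'e) univ =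
    Re real
  | Pt "real^'k"
  | Gr "((real^'k) \<times> real) set"
  | Ob 'e

definition tuples :: "nat \<Rightarrow> 'a list set" where
  "tuples m = {xs. length xs = m}"

text \<open>
  A nonstandard extension in the sense of C. W. Henson (\<open>Foundations of nonstandard analysis:
  a gentle introduction to nonstandard extensions\<close>): a map sending each set of \<open>m\<close>-tuples of
  standard objects to a set of \<open>m\<close>-tuples of elements of the extension, compatible with Boolean
  operations, diagonals, products, and projections. This is equivalent to the transfer
  principle for first-order formulas, with all relations on the standard universe as primitives. The
  elements of the type \<open>'w\<close> are the elements of the extension of the standard universe, i.e. the
  internal objects. Only the values of the map at sets of tuples of one fixed length matter.
\<close>

definition nonstandard_extension :: "('u list set \<Rightarrow> 'w list set) \<Rightarrow> bool" where
  "nonstandard_extension star \<longleftrightarrow>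
     (\<forall>m. star (tuples m) = tuples m) \<and>
     (\<forall>m A B. A \<subseteq> tuples m \<and> B \<subseteq> tuples m \<longrightarrow> star (A \<union> B) = star A \<union> star B) \<and>
     (\<forall>m A. A \<subseteq> tuples m \<longrightarrow> star (tuples m - A) = tuples m - star A) \<and>
     (\<forall>m i j. i < m \<and> j < m \<longrightarrow>
        star {xs \<in> tuples m. xs ! i = xs ! j} = {xs \<in> tuples m. xs ! i = xs ! j}) \<and>
     (\<forall>m n A B. A \<subseteq> tuples m \<and> B \<subseteq> tuples n \<longrightarrow>
        star {xs @ ys | xs ys. xs \<in> A \<and> ys \<in> B} = {xs @ ys | xs ys. xs \<in> star A \<and> ys \<in> star B}) \<and>
     (\<forall>m A. A \<subseteq> tuples (Suc m) \<longrightarrow> star (butlast ` A) = butlast ` star A)"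

text \<open>
  Internal sets of \<open>m\<close>-tuples are the sets definable from an extended relation and internal
  parameters. A subset of the extension of \<open>B\<close> is internal in this sense iff it belongs to the
  extension of the power set of \<open>B\<close>, whenever the standard universe contains that power set; by
  the constructor \<open>Gr\<close> it does for the product of the space of points with the reals.
\<close>

definition internal_set :: "('u list set \<Rightarrow> 'w list set) \<Rightarrow> nat \<Rightarrow> 'w list set \<Rightarrow> bool" where
  "internal_set star m S \<longleftrightarrow>
     (\<exists>n R ps. R \<subseteq> tuples (m + n) \<and> length ps = n \<and> S = {xs \<in> tuples m. xs @ ps \<in> star R})"

text \<open>
  Saturation with respect to the cardinality of a set \<open>K\<close>, with the convention that the families
  have fewer than \<open>|K|\<close> members (a weaker condition than with at most \<open>|K|\<close> members).
\<close>

definition saturated :: "'c set \<Rightarrow> ('u list set \<Rightarrow> 'w list set) \<Rightarrow> bool" where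
  "saturated K star \<longleftrightarrow>
     (\<forall>m F. F \<prec> K \<and> (\<forall>S\<in>F. internal_set star m S) \<and>
            (\<forall>F0. F0 \<subseteq> F \<and> finite F0 \<longrightarrow> \<Inter>F0 \<noteq> {}) \<longrightarrow> \<Inter>F \<noteq> {})"

definition star_elem :: "('u list set \<Rightarrow> 'w list set) \<Rightarrow> 'u \<Rightarrow> 'w" where
  "star_elem star u = (THE w. star {[u]} = {[w]})"

text \<open>
  In the next three definitions \<open>c\<close>, \<open>d\<close>, \<open>e\<close> are constructors of the standard universe, that say
  where the standard sets and functions live.
\<close>

definition star_set :: "('u list set \<Rightarrow> 'w list set) \<Rightarrow> ('a \<Rightarrow> 'u) \<Rightarrow> 'a set \<Rightarrow> 'w set" where
  "star_set star c A = {w. [w] \<in> star {[c a] | a. a \<in> A}}"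

definition star_fun ::
    "('u list set \<Rightarrow> 'w list set) \<Rightarrow> ('a \<Rightarrow> 'u) \<Rightarrow> ('b \<Rightarrow> 'u) \<Rightarrow> ('a \<Rightarrow> 'b) \<Rightarrow> 'w \<Rightarrow> 'w" where
  "star_fun star c d F x = (THE y. [x, y] \<in> star {[c a, d (F a)] | a. True})"

definition star_fun2 ::
    "('u list set \<Rightarrow> 'w list set) \<Rightarrow> ('a \<Rightarrow> 'u) \<Rightarrow> ('b \<Rightarrow> 'u) \<Rightarrow> ('c \<Rightarrow> 'u) \<Rightarrow>
      ('a \<Rightarrow> 'b \<Rightarrow> 'c) \<Rightarrow> 'w \<Rightarrow> 'w \<Rightarrow> 'w" where
  "star_fun2 star c d e F x y = (THE z. [x, y, z] \<in> star {[c a, d b, e (F a b)] | a b. True})"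


section \<open>Hyperreal numbers\<close>

type_synonym ('k, 'e, 'w) star_map = "('k, 'e) univ list set \<Rightarrow> 'w list set"

definition hypreal :: "('k::finite, 'e, 'w) star_map \<Rightarrow> 'w set" where
  "hypreal star = star_set star Re UNIV"

definition hypnat :: "('k::finite, 'e, 'w) star_map \<Rightarrow> 'w set" where
  "hypnat star = star_set star Re \<nat>"

definition hypint :: "('k::finite, 'e, 'w) star_map \<Rightarrow> 'w set" where
  "hypint star = star_set star Re \<int>"

definition hreal :: "('k::finite, 'e, 'w) star_map \<Rightarrow> real \<Rightarrow> 'w" where
  "hreal star r = star_elem star (Re r)"

definition hfun :: "('k::finite, 'e, 'w) star_map \<Rightarrow> (real \<Rightarrow> real) \<Rightarrow> 'w \<Rightarrow> 'w" where
  "hfun star = star_fun star Re Re"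

definition hop :: "('k::finite, 'e, 'w) star_map \<Rightarrow> (real \<Rightarrow> real \<Rightarrow> real) \<Rightarrow> 'w \<Rightarrow> 'w \<Rightarrow> 'w" where
  "hop star = star_fun2 star Re Re Re"

definition hle :: "('k::finite, 'e, 'w) star_map \<Rightarrow> 'w \<Rightarrow> 'w \<Rightarrow> bool" where
  "hle star x y \<longleftrightarrow> [x, y] \<in> star {[Re a, Re b] | a b. a \<le> b}"

definition hless :: "('k::finite, 'e, 'w) star_map \<Rightarrow> 'w \<Rightarrow> 'w \<Rightarrow> bool" where
  "hless star x y \<longleftrightarrow> [x, y] \<in> star {[Re a, Re b] | a b. a < b}"

definition hfinite :: "('k::finite, 'e, 'w) star_map \<Rightarrow> 'w \<Rightarrow> bool" where
  "hfinite star x \<longleftrightarrow> x \<in> hypreal star \<and> (\<exists>r. hle star (hfun star abs x) (hreal star r))"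

text \<open>\<open>x\<close> is a finite hyperreal and its standard part is \<open>r\<close>.\<close>

definition has_std_part :: "('k::finite, 'e, 'w) star_map \<Rightarrow> 'w \<Rightarrow> real \<Rightarrow> bool" where
  "has_std_part star x r \<longleftrightarrow>
     x \<in> hypreal star \<and>
     (\<forall>e>0. hless star (hfun star abs (hop star (-) x (hreal star r))) (hreal star e))"

definition infinite_hypnat :: "('k::finite, 'e, 'w) star_map \<Rightarrow> 'w \<Rightarrow> bool" where
  "infinite_hypnat star n \<longleftrightarrow> n \<in> hypnat star \<and> (\<forall>r. hless star (hreal star r) n)"


section \<open>Grid functions\<close>

text \<open>The number \<open>N = N\<^sub>0!\<close>; the real function extended here agrees with the factorial on \<open>\<nat>\<close>.\<close>

definition grid_N :: "('k::finite, 'e, 'w) star_map \<Rightarrow> 'w \<Rightarrow> 'w" where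
  "grid_N star N0 = hfun star (\<lambda>a. fact (nat \<lfloor>a\<rfloor>)) N0"

definition grid_eps :: "('k::finite, 'e, 'w) star_map \<Rightarrow> 'w \<Rightarrow> 'w" where
  "grid_eps star N0 = hop star (/) (hreal star 1) (grid_N star N0)"

definition grid :: "('k::finite, 'e, 'w) star_map \<Rightarrow> 'w \<Rightarrow> 'w set" where
  "grid star N0 =
     {hop star (*) n (grid_eps star N0) | n. n \<in> hypint star \<and>
        hle star (hfun star (\<lambda>a. - (a^2)) (grid_N star N0)) n \<and>
        hle star n (hfun star (\<lambda>a. a^2) (grid_N star N0))}"

text \<open>The points of the extended space are identified with the tuples of their coordinates.\<close>

definition grid_dom :: "('k::finite, 'e, 'w) star_map \<Rightarrow> 'w \<Rightarrow> (real^'k) set \<Rightarrow> 'w set" where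
  "grid_dom star N0 \<Omega> =
     {x \<in> star_set star Pt \<Omega>. \<forall>i. star_fun star Pt Re (\<lambda>v. v $ i) x \<in> grid star N0}"

text \<open>The values of a grid function outside the domain are irrelevant.\<close>

definition grid_functions ::
    "('k::finite, 'e, 'w) star_map \<Rightarrow> 'w \<Rightarrow> (real^'k) set \<Rightarrow> ('w \<Rightarrow> 'w) set" where
  "grid_functions star N0 \<Omega> =
     {f. (\<forall>x \<in> grid_dom star N0 \<Omega>. f x \<in> hypreal star) \<and>
         internal_set star 2 {[x, f x] | x. x \<in> grid_dom star N0 \<Omega>}}"

text \<open>
  Hyperfinite sum of \<open>g\<close> over \<open>A\<close>: the extension of the map that sends a finite graph to the sum
  of its values, applied to the internal object \<open>G\<close> whose members are the pairs \<open>(x, g x)\<close> with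
  \<open>x\<close> in \<open>A\<close>.
\<close>

definition hsum :: "('k::finite, 'e, 'w) star_map \<Rightarrow> 'w set \<Rightarrow> ('w \<Rightarrow> 'w) \<Rightarrow> 'w" where
  "hsum star A g =
     (THE s. \<exists>G. (\<forall>x y. [x, y, G] \<in> star {[Pt a, Re b, Gr R] | a b R. (a, b) \<in> R} \<longleftrightarrow>
                         x \<in> A \<and> y = g x) \<and>
                 [G, s] \<in> star {[Gr R, Re (\<Sum>(a, b)\<in>R. b)] | R. finite R})"

definition grid_inner ::
    "('k::finite, 'e, 'w) star_map \<Rightarrow> 'w \<Rightarrow> (real^'k) set \<Rightarrow> ('w \<Rightarrow> 'w) \<Rightarrow> ('w \<Rightarrow> 'w) \<Rightarrow> 'w" where
  "grid_inner star N0 \<Omega> f g =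
     hop star (*) (hfun star (\<lambda>a. a ^ CARD('k)) (grid_eps star N0))
       (hsum star (grid_dom star N0 \<Omega>) (\<lambda>x. hop star (*) (f x) (g x)))"

text \<open>The maximum over the empty domain, i.e. for \<open>\<Omega> = {}\<close>, is \<open>0\<close>.\<close>

definition grid_norm_inf ::
    "('k::finite, 'e, 'w) star_map \<Rightarrow> 'w \<Rightarrow> (real^'k) set \<Rightarrow> ('w \<Rightarrow> 'w) \<Rightarrow> 'w" where
  "grid_norm_inf star N0 \<Omega> f =
     (if grid_dom star N0 \<Omega> = {} then hreal star 0
      else THE m. (\<exists>x \<in> grid_dom star N0 \<Omega>. m = hfun star abs (f x)) \<and>
                  (\<forall>x \<in> grid_dom star N0 \<Omega>. hle star (hfun star abs (f x)) m))"


section \<open>Function spaces, distributions, Young measures\<close>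

text \<open>Functions with support in \<open>\<Omega>\<close> are taken to be defined, with value \<open>0\<close>, also outside \<open>\<Omega>\<close>.\<close>

definition compact_support_in :: "(real^'k::finite) set \<Rightarrow> (real^'k \<Rightarrow> real) \<Rightarrow> bool" where
  "compact_support_in \<Omega> \<phi> \<longleftrightarrow> compact (closure {x. \<phi> x \<noteq> 0}) \<and> closure {x. \<phi> x \<noteq> 0} \<subseteq> \<Omega>"

definition C0b :: "(real \<Rightarrow> real) set" where
  "C0b = {\<Psi>. continuous_on UNIV \<Psi> \<and> bounded (range \<Psi>) \<and> (\<Psi> \<longlongrightarrow> 0) at_infinity}"

definition C0c :: "(real^'k::finite) set \<Rightarrow> (real^'k \<Rightarrow> real) set" where
  "C0c \<Omega> = {\<phi>. continuous_on UNIV \<phi> \<and> compact_support_in \<Omega> \<phi>}"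

definition part_deriv :: "'k::finite \<Rightarrow> (real^'k \<Rightarrow> real) \<Rightarrow> real^'k \<Rightarrow> real" where
  "part_deriv i \<phi> x = deriv (\<lambda>t. \<phi> (x + t *\<^sub>R axis i 1)) 0"

primrec C_k :: "nat \<Rightarrow> (real^'k::finite \<Rightarrow> real) \<Rightarrow> bool" where
  "C_k 0 \<phi> \<longleftrightarrow> continuous_on UNIV \<phi>"
| "C_k (Suc n) \<phi> \<longleftrightarrow> continuous_on UNIV \<phi> \<and>
     (\<forall>i. (\<forall>x. (\<lambda>t. \<phi> (x + t *\<^sub>R axis i 1)) differentiable (at 0)) \<and> C_k n (part_deriv i \<phi>))"

definition test_functions :: "(real^'k::finite) set \<Rightarrow> (real^'k \<Rightarrow> real) set" where
  "test_functions \<Omega> = {\<phi>. (\<forall>n. C_k n \<phi>) \<and> compact_support_in \<Omega> \<phi>}"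

text \<open>
  Continuity of distributions is expressed by the usual seminorm estimates; \<open>fold part_deriv is\<close>
  is the iterated partial derivative in the directions listed in \<open>is\<close>. Distributions are
  \<open>undefined\<close> outside the test functions, so that distinct elements of the set below are distinct
  functionals; this matters for its cardinality.
\<close>

definition distributions :: "(real^'k::finite) set \<Rightarrow> ((real^'k \<Rightarrow> real) \<Rightarrow> real) set" where
  "distributions \<Omega> =
     {T \<in> extensional (test_functions \<Omega>).
        (\<forall>\<phi>\<in>test_functions \<Omega>. \<forall>\<psi>\<in>test_functions \<Omega>. \<forall>a b.
            T (\<lambda>x. a * \<phi> x + b * \<psi> x) = a * T \<phi> + b * T \<psi>) \<and>
        (\<forall>K. compact K \<and> K \<subseteq> \<Omega> \<longrightarrow>
           (\<exists>n C. \<forall>\<phi>\<in>test_functions \<Omega>. closure {x. \<phi> x \<noteq> 0} \<subseteq> K \<longrightarrow>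
              (\<forall>B. (\<forall>is x. length is \<le> n \<longrightarrow> \<bar>fold part_deriv is \<phi> x\<bar> \<le> B) \<longrightarrow>
                   \<bar>T \<phi>\<bar> \<le> C * B)))}"

definition Linf :: "(real^'k::finite) set \<Rightarrow> (real^'k \<Rightarrow> real) set" where
  "Linf \<Omega> = {h \<in> borel_measurable (lebesgue_on \<Omega>). \<exists>C. AE x in lebesgue_on \<Omega>. \<bar>h x\<bar> \<le> C}"

text \<open>
  The functional sending a test function \<open>\<phi>\<close> to the standard part of the inner product of \<open>f\<close> with
  the extension of \<open>\<phi>\<close> is well-defined, and it is integration against the essentially bounded
  function \<open>h\<close>.
\<close>

definition grid_distr_is ::
    "('k::finite, 'e, 'w) star_map \<Rightarrow> 'w \<Rightarrow> (real^'k) set \<Rightarrow> ('w \<Rightarrow> 'w) \<Rightarrow>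
      (real^'k \<Rightarrow> real) \<Rightarrow> bool" where
  "grid_distr_is star N0 \<Omega> f h \<longleftrightarrow>
     h \<in> Linf \<Omega> \<and>
     (\<forall>\<phi> \<in> test_functions \<Omega>.
        has_std_part star (grid_inner star N0 \<Omega> f (star_fun star Pt Re \<phi>))
          (LINT x|lebesgue_on \<Omega>. h x * \<phi> x))"

text \<open>
  Every Borel probability measure on the real line is Radon, and the Giry sigma-algebra of
  \<open>prob_algebra borel\<close> is the Borel sigma-algebra of the weak topology.
\<close>

definition young_measure :: "(real^'k::finite) set \<Rightarrow> (real^'k \<Rightarrow> real measure) \<Rightarrow> bool" where
  "young_measure \<Omega> \<nu> \<longleftrightarrow> \<nu> \<in> lebesgue_on \<Omega> \<rightarrow>\<^sub>M prob_algebra borel"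

definition dirac_young_measure :: "(real^'k::finite) set \<Rightarrow> (real^'k \<Rightarrow> real measure) \<Rightarrow> bool" where
  "dirac_young_measure \<Omega> \<nu> \<longleftrightarrow> (\<forall>x\<in>\<Omega>. \<exists>y. \<nu> x = return borel y)"

definition is_grid_young_measure ::
    "('k::finite, 'e, 'w) star_map \<Rightarrow> 'w \<Rightarrow> (real^'k) set \<Rightarrow> ('w \<Rightarrow> 'w) \<Rightarrow>
      (real^'k \<Rightarrow> real measure) \<Rightarrow> bool" where
  "is_grid_young_measure star N0 \<Omega> f \<nu> \<longleftrightarrow>
     young_measure \<Omega> \<nu> \<and>
     (\<forall>\<Psi> \<in> C0b. \<forall>\<phi> \<in> C0c \<Omega>.
        has_std_part star
          (grid_inner star N0 \<Omega> (\<lambda>x. hfun star \<Psi> (f x)) (star_fun star Pt Re \<phi>))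
          (LINT x|lebesgue_on \<Omega>. (LINT t|\<nu> x. \<Psi> t) * \<phi> x))"

definition weakly_star_to_young ::
    "(real^'k::finite) set \<Rightarrow> (nat \<Rightarrow> real^'k \<Rightarrow> real) \<Rightarrow> (real^'k \<Rightarrow> real measure) \<Rightarrow> bool" where
  "weakly_star_to_young \<Omega> fs \<nu> \<longleftrightarrow>
     (\<forall>\<Psi> \<in> C0b. \<forall>\<phi>. integrable (lebesgue_on \<Omega>) \<phi> \<longrightarrow>
        (\<lambda>n. LINT x|lebesgue_on \<Omega>. \<Psi> (fs n x) * \<phi> x)
          \<longlonglongrightarrow> (LINT x|lebesgue_on \<Omega>. (LINT t|\<nu> x. \<Psi> t) * \<phi> x))"

definition weakly_star_Linf ::
    "(real^'k::finite) set \<Rightarrow> (nat \<Rightarrow> real^'k \<Rightarrow> real) \<Rightarrow> (real^'k \<Rightarrow> real) \<Rightarrow> bool" where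
  "weakly_star_Linf \<Omega> fs h \<longleftrightarrow>
     (\<forall>\<phi>. integrable (lebesgue_on \<Omega>) \<phi> \<longrightarrow>
        (\<lambda>n. LINT x|lebesgue_on \<Omega>. fs n x * \<phi> x) \<longlonglongrightarrow> (LINT x|lebesgue_on \<Omega>. h x * \<phi> x))"

end

theory Submission
  imports Defs
begin

text \<open>
  Internal functions on the hyperfinite grid attain their maximum, so \<open>f\<close> takes values in
  \<open>[-r, r]\<close> for a standard \<open>r\<close>. If \<open>\<Psi>\<^sub>1\<close> and \<open>\<Psi>\<^sub>2\<close> agree on \<open>[-r, r]\<close>, then \<open>*\<Psi>\<^sub>1(f)\<close> and
  \<open>*\<Psi>\<^sub>2(f)\<close> are the same grid function, so the integrals representing them through \<open>\<nu>\<close> are equal.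
  With \<open>\<Psi>\<^sub>2 = 0\<close> and a \<open>\<Psi>\<^sub>1\<close> that is positive exactly outside \<open>[-r, r]\<close> this shows that almost
  every \<open>\<nu> x\<close> is carried by \<open>[-r, r]\<close>. A function in \<open>C0b\<close> that is the identity on a large interval
  then stands for the identity in the convergence statements as well as in the inner product.
\<close>

section \<open>Transfer\<close>

context
  fixes star :: "'u list set \<Rightarrow> 'w list set"
  assumes ext: "nonstandard_extension star"
begin

lemma star_tuples: "star (tuples m) = tuples m"
  and star_Un: "A \<subseteq> tuples m \<Longrightarrow> B \<subseteq> tuples m \<Longrightarrow> star (A \<union> B) = star A \<union> star B"
  and star_compl: "A \<subseteq> tuples m \<Longrightarrow> star (tuples m - A) = tuples m - star A"
  and star_diag: "i < m \<Longrightarrow> j < m \<Longrightarrow>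
        star {xs \<in> tuples m. xs ! i = xs ! j} = {xs \<in> tuples m. xs ! i = xs ! j}"
  and star_append: "A \<subseteq> tuples m \<Longrightarrow> B \<subseteq> tuples n \<Longrightarrow>
        star {xs @ ys | xs ys. xs \<in> A \<and> ys \<in> B} = {xs @ ys | xs ys. xs \<in> star A \<and> ys \<in> star B}"
  and star_butlast: "A \<subseteq> tuples (Suc m) \<Longrightarrow> star (butlast ` A) = butlast ` star A"
proof -
  note c = ext[unfolded nonstandard_extension_def]
  show "star (tuples m) = tuples m"
    by (rule c[THEN conjunct1, rule_format])
  show "A \<subseteq> tuples m \<Longrightarrow> B \<subseteq> tuples m \<Longrightarrow> star (A \<union> B) = star A \<union> star B"
    by (rule c[THEN conjunct2, THEN conjunct1, rule_format], rule conjI)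
  show "A \<subseteq> tuples m \<Longrightarrow> star (tuples m - A) = tuples m - star A"
    by (rule c[THEN conjunct2, THEN conjunct2, THEN conjunct1, rule_format])
  show "i < m \<Longrightarrow> j < m \<Longrightarrow>
      star {xs \<in> tuples m. xs ! i = xs ! j} = {xs \<in> tuples m. xs ! i = xs ! j}"
    by (rule c[THEN conjunct2, THEN conjunct2, THEN conjunct2, THEN conjunct1, rule_format], rule conjI)
  show "A \<subseteq> tuples m \<Longrightarrow> B \<subseteq> tuples n \<Longrightarrow>
      star {xs @ ys | xs ys. xs \<in> A \<and> ys \<in> B} = {xs @ ys | xs ys. xs \<in> star A \<and> ys \<in> star B}"
    by (rule c[THEN conjunct2, THEN conjunct2, THEN conjunct2, THEN conjunct2, THEN conjunct1, rule_format],
      rule conjI)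
  show "A \<subseteq> tuples (Suc m) \<Longrightarrow> star (butlast ` A) = butlast ` star A"
    by (rule c[THEN conjunct2, THEN conjunct2, THEN conjunct2, THEN conjunct2, THEN conjunct2, rule_format])
qed

lemma star_subset_tuples: "A \<subseteq> tuples m \<Longrightarrow> star A \<subseteq> tuples m"
  using star_Un[of A m "tuples m"] star_tuples[of m] by (auto simp: Un_absorb1)

lemma star_Int:
  assumes "A \<subseteq> tuples m" "B \<subseteq> tuples m"
  shows "star (A \<inter> B) = star A \<inter> star B"
proof -
  have "A \<inter> B = tuples m - ((tuples m - A) \<union> (tuples m - B))"
    using assms by blast
  then have "star (A \<inter> B) = tuples m - ((tuples m - star A) \<union> (tuples m - star B))"
    using assms by (simp add: star_compl star_Un[of _ m] le_supI)
  then show ?thesis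
    using star_subset_tuples assms by blast
qed

text \<open>Meeting with \<open>tuples m\<close> gives the empty family a meaningful value; a bare
  empty intersection would contain lists of every length.\<close>

lemma star_INT:
  assumes "finite I" "\<And>i. i \<in> I \<Longrightarrow> A i \<subseteq> tuples m"
  shows "star (tuples m \<inter> (\<Inter>i\<in>I. A i)) = tuples m \<inter> (\<Inter>i\<in>I. star (A i))"
  using assms
proof (induction I rule: finite_induct)
  case empty
  then show ?case by (simp add: star_tuples)
next
  case (insert i I)
  have "star (A i \<inter> (tuples m \<inter> (\<Inter>i\<in>I. A i))) = star (A i) \<inter> star (tuples m \<inter> (\<Inter>i\<in>I. A i))"
    using insert.prems by (intro star_Int[of _ m]) auto
  then show ?case
    using insert by (simp add: Int_left_commute Int_commute Int_assoc)
qed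

text \<open>The projection axiom drops one entry, so \<open>k\<close> entries go by induction. The
  auxiliary identities hold over any element type because they are applied to \<open>A\<close> and
  to \<open>star A\<close> alike.\<close>

lemma star_take:
  assumes "A \<subseteq> tuples (m + k)"
  shows "star (take m ` A) = take m ` star A"
  using assms
proof (induction k arbitrary: A)
  case 0
  have "take m ` B = B" if "B \<subseteq> tuples m" for B :: "'x list set"
    using that by (force simp: tuples_def)
  from this[of A] this[of "star A"] show ?case
    using 0 star_subset_tuples[of A m] by simp
next
  case (Suc k)
  have eq: "take m ` butlast ` B = take m ` B" if "B \<subseteq> tuples (Suc (m + k))" for B :: "'x list set"
    unfolding image_image using that
    by (intro image_cong) (auto simp: tuples_def take_butlast)
  have "butlast ` A \<subseteq> tuples (m + k)"
    using Suc.prems by (auto simp: tuples_def)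
  then have "star (take m ` butlast ` A) = take m ` star (butlast ` A)"
    by (rule Suc.IH)
  then show ?case
    using Suc.prems star_subset_tuples[of A "Suc (m + k)"] by (simp add: eq star_butlast)
qed

lemma star_diags:
  fixes k :: nat
  assumes "\<And>j. j < k \<Longrightarrow> a j < m \<and> b j < m"
  shows "star {xs \<in> tuples m. \<forall>j<k. xs ! a j = xs ! b j} = {xs \<in> tuples m. \<forall>j<k. xs ! a j = xs ! b j}"
proof -
  have eq: "{xs \<in> tuples m. \<forall>j<k. xs ! a j = xs ! b j} =
      tuples m \<inter> (\<Inter>j\<in>{..<k}. {xs \<in> (tuples m :: 'u list set). xs ! a j = xs ! b j})"
    by auto
  show ?thesis
    unfolding eq using assms by (subst star_INT[OF finite_lessThan]) (auto simp: star_diag)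
qed

text \<open>Permuting, repeating and adding variables reduces to the axioms: append a tuple of
  \<open>A\<close> to \<open>xs\<close>, force its entries by diagonals to be the selected entries
  of \<open>xs\<close>, and project the appended block away.\<close>

lemma star_subst:
  assumes A: "A \<subseteq> tuples (length js)" and js: "\<forall>i\<in>set js. i < m"
  shows "star {xs \<in> tuples m. map ((!) xs) js \<in> A} = {xs \<in> tuples m. map ((!) xs) js \<in> star A}"
proof -
  let ?k = "length js"
  let ?D = "\<lambda>zs. \<forall>j<?k. zs ! (js ! j) = zs ! (m + j)"
  \<comment> \<open>Polymorphic in the entries, since it serves \<open>A\<close> on the standard
    side and \<open>star A\<close> on the other.\<close>
  have eq: "{xs \<in> tuples m. map ((!) xs) js \<in> B} =
      take m ` ({xs @ ys | xs ys. xs \<in> tuples m \<and> ys \<in> B} \<inter> {zs \<in> tuples (m + ?k). ?D zs})"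
    if B: "B \<subseteq> tuples ?k" for B :: "'x list set"
  proof (intro equalityI subsetI)
    fix xs assume xs: "xs \<in> {xs \<in> tuples m. map ((!) xs) js \<in> B}"
    let ?z = "xs @ map ((!) xs) js"
    have "?z \<in> {xs @ ys | xs ys. xs \<in> tuples m \<and> ys \<in> B} \<inter> {zs \<in> tuples (m + ?k). ?D zs}"
      using xs js by (auto simp: tuples_def nth_append)
    moreover have "xs = take m ?z"
      using xs by (auto simp: tuples_def)
    ultimately show "xs \<in> take m ` ({xs @ ys | xs ys. xs \<in> tuples m \<and> ys \<in> B} \<inter> {zs \<in> tuples (m + ?k). ?D zs})"
      by blast
  next
    fix us assume "us \<in> take m ` ({xs @ ys | xs ys. xs \<in> tuples m \<and> ys \<in> B} \<inter> {zs \<in> tuples (m + ?k). ?D zs})"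
    then obtain xs ys where *: "xs \<in> tuples m" "ys \<in> B" "?D (xs @ ys)" "us = xs"
      by (auto simp: tuples_def)
    have "map ((!) xs) js = ys"
    proof (rule nth_equalityI)
      show len: "length (map ((!) xs) js) = length ys"
        using *(2) B by (auto simp: tuples_def)
      show "map ((!) xs) js ! i = ys ! i" if "i < length (map ((!) xs) js)" for i
        using that *(1,3) js by (auto simp: tuples_def nth_append dest!: spec[of _ i])
    qed
    then show "us \<in> {xs \<in> tuples m. map ((!) xs) js \<in> B}"
      using * by simp
  qed
  let ?P = "{xs @ ys | xs ys. xs \<in> tuples m \<and> ys \<in> A}"
  let ?E = "{zs \<in> (tuples (m + ?k) :: 'u list set). ?D zs}"
  have P: "?P \<subseteq> tuples (m + ?k)"
    using A by (auto simp: tuples_def)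
  have "star {xs \<in> tuples m. map ((!) xs) js \<in> A} = star (take m ` (?P \<inter> ?E))"
    by (simp only: eq[OF A])
  also have "\<dots> = take m ` star (?P \<inter> ?E)"
    using P by (intro star_take) auto
  also have "star (?P \<inter> ?E) = star ?P \<inter> star ?E"
    using P by (intro star_Int) auto
  also have "star ?P = {xs @ ys | xs ys. xs \<in> tuples m \<and> ys \<in> star A}"
    using star_append[OF order.refl A, of m] by (simp add: star_tuples)
  also have "star ?E = {zs \<in> tuples (m + ?k). ?D zs}"
    using js by (intro star_diags) (auto simp: trans_less_add1)
  also have "take m ` ({xs @ ys | xs ys. xs \<in> tuples m \<and> ys \<in> star A} \<inter> {zs \<in> tuples (m + ?k). ?D zs})
      = {xs \<in> tuples m. map ((!) xs) js \<in> star A}"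
    by (rule eq[OF star_subset_tuples[OF A], symmetric])
  finally show ?thesis .
qed

end

text \<open>First-order formulas with de Bruijn levels: variable \<open>i\<close> is entry \<open>i\<close> of the assignment, and a
  quantifier binds the next entry.\<close>

datatype 'u fm = Rel "'u list set" "nat list" | Eq nat nat | Neg "'u fm" | Con "'u fm" "'u fm" | FEx "'u fm"

primrec sat :: "('u list set \<Rightarrow> 'w list set) \<Rightarrow> 'u fm \<Rightarrow> 'w list \<Rightarrow> bool" where
  "sat I (Rel A js) xs \<longleftrightarrow> map ((!) xs) js \<in> I A"
| "sat I (Eq i j) xs \<longleftrightarrow> xs ! i = xs ! j"
| "sat I (Neg p) xs \<longleftrightarrow> \<not> sat I p xs"
| "sat I (Con p q) xs \<longleftrightarrow> sat I p xs \<and> sat I q xs"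
| "sat I (FEx p) xs \<longleftrightarrow> (\<exists>y. sat I p (xs @ [y]))"

primrec wff :: "nat \<Rightarrow> 'u fm \<Rightarrow> bool" where
  "wff m (Rel A js) \<longleftrightarrow> A \<subseteq> tuples (length js) \<and> (\<forall>i\<in>set js. i < m)"
| "wff m (Eq i j) \<longleftrightarrow> i < m \<and> j < m"
| "wff m (Neg p) \<longleftrightarrow> wff m p"
| "wff m (Con p q) \<longleftrightarrow> wff m p \<and> wff m q"
| "wff m (FEx p) \<longleftrightarrow> wff (Suc m) p"

definition Imp :: "'u fm \<Rightarrow> 'u fm \<Rightarrow> 'u fm" where "Imp p q = Neg (Con p (Neg q))"
definition FAll :: "'u fm \<Rightarrow> 'u fm" where "FAll p = Neg (FEx (Neg p))"

lemma sat_Imp_All [simp]: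
  "sat I (Imp p q) xs \<longleftrightarrow> (sat I p xs \<longrightarrow> sat I q xs)"
  "sat I (FAll p) xs \<longleftrightarrow> (\<forall>y. sat I p (xs @ [y]))"
  "wff m (Imp p q) \<longleftrightarrow> wff m p \<and> wff m q"
  "wff m (FAll p) \<longleftrightarrow> wff (Suc m) p"
  by (auto simp: Imp_def FAll_def)

text \<open>Quantifying the next variable is projection along the last coordinate, the form in which
  the axioms treat it.\<close>

lemma Collect_ex_eq_butlast:
  "{xs \<in> tuples m. \<exists>y. P (xs @ [y])} = butlast ` {zs \<in> tuples (Suc m). P zs}"
proof (intro equalityI subsetI)
  fix xs assume "xs \<in> {xs \<in> tuples m. \<exists>y. P (xs @ [y])}"
  then obtain y where "length xs = m" "P (xs @ [y])" by (auto simp: tuples_def)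
  then show "xs \<in> butlast ` {zs \<in> tuples (Suc m). P zs}"
    by (intro image_eqI[of _ _ "xs @ [y]"]) (auto simp: tuples_def)
next
  fix xs assume "xs \<in> butlast ` {zs \<in> tuples (Suc m). P zs}"
  then obtain zs where "length zs = Suc m" "P zs" "xs = butlast zs" by (auto simp: tuples_def)
  moreover from this have "xs @ [last zs] = zs"
    by (cases zs rule: rev_cases) auto
  ultimately show "xs \<in> {xs \<in> tuples m. \<exists>y. P (xs @ [y])}"
    by (auto simp: tuples_def intro!: exI[of _ "last zs"])
qed

text \<open>Each constructor of formulas matches one closure property: atoms are substitutions,
  equalities diagonals, negations complements, conjunctions intersections, quantifiers projections.
  \<open>m\<close> varies because a quantifier lengthens the assignment.\<close>

theorem star_sat:
  assumes ext: "nonstandard_extension star" and "wff m p"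
  shows "star {xs \<in> tuples m. sat id p xs} = {xs \<in> tuples m. sat star p xs}"
  using assms(2)
proof (induction p arbitrary: m)
  case (Rel A js)
  then show ?case using star_subst[OF ext, of A js m] by simp
next
  case (Eq i j)
  then show ?case using star_diag[OF ext, of i m j] by simp
next
  case (Neg p)
  have eq: "{xs \<in> tuples m. \<not> P xs} = tuples m - {xs \<in> tuples m. P xs}" for P :: "'x list \<Rightarrow> bool"
    by auto
  show ?case
    using Neg star_compl[OF ext, of "{xs \<in> tuples m. sat id p xs}" m] by (simp add: eq del: id_apply)
next
  case (Con p q)
  have eq: "{xs \<in> tuples m. P xs \<and> Q xs} = {xs \<in> tuples m. P xs} \<inter> {xs \<in> tuples m. Q xs}"
    for P Q :: "'x list \<Rightarrow> bool"
    by auto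
  show ?case
    using Con star_Int[OF ext, of "{xs \<in> tuples m. sat id p xs}" m "{xs \<in> tuples m. sat id q xs}"]
    by (simp add: eq del: id_apply)
next
  case (FEx p)
  then show ?case
    using star_butlast[OF ext, of "{xs \<in> tuples (Suc m). sat id p xs}" m]
    by (simp add: Collect_ex_eq_butlast del: id_apply)
qed

text \<open>A formula true of all standard tuples of a given length defines the full set of them,
  which the extension fixes. What is known about particular elements \<open>ws\<close> enters as
  premises inside the formula.\<close>

corollary transfer:
  assumes "nonstandard_extension star" "wff (length ws) p"
    and "\<And>xs. length xs = length ws \<Longrightarrow> sat id p xs"
  shows "sat star p ws"
proof -
  have "{xs \<in> tuples (length ws). sat id p xs} = tuples (length ws)"
    using assms(3) by (auto simp: tuples_def)
  then have "ws \<in> {xs \<in> tuples (length ws). sat star p xs}"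
    using star_sat[OF assms(1,2)] star_tuples[OF assms(1), of "length ws"] by (auto simp: tuples_def)
  then show ?thesis by simp
qed

section \<open>Hyperreals\<close>

lemma star_fun_graph:
  assumes ext: "nonstandard_extension star" and c: "inj c" and x: "x \<in> star_set star c UNIV"
  shows "[x, star_fun star c d F x] \<in> star {[c a, d (F a)] | a. True}"
proof -
  let ?G = "{[c a, d (F a)] | a. True}"
  \<comment> \<open>Totality of the graph transfers and provides a value.\<close>
  have "sat star (Imp (Rel {[c a] | a. a \<in> UNIV} [0]) (FEx (Rel ?G [0, 1]))) [x]"
    by (rule transfer[OF ext]) (auto simp: tuples_def length_Suc_conv)
  then obtain y where y: "[x, y] \<in> star ?G"
    using x by (auto simp: star_set_def)
  \<comment> \<open>Single-valuedness transfers as well; injectivity of \<open>c\<close> ensures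
    that one code stands for one argument.\<close>
  have "z = y" if "[x, z] \<in> star ?G" for z
  proof -
    have "sat star (Imp (Rel ?G [0, 1]) (Imp (Rel ?G [0, 2]) (Eq 1 2))) [x, z, y]"
      by (rule transfer[OF ext]) (auto simp: tuples_def length_Suc_conv simp: inj_eq[OF c])
    then show ?thesis using that y by simp
  qed
  then show ?thesis
    unfolding star_fun_def using y by (rule theI[of _ y, rotated])
qed

lemma star_fun_mem:
  assumes ext: "nonstandard_extension star" and "inj c" "x \<in> star_set star c UNIV"
  shows "star_fun star c d F x \<in> star_set star d UNIV"
proof -
  have "sat star (Imp (Rel {[c a, d (F a)] | a. True} [0, 1]) (Rel {[d a] | a. a \<in> UNIV} [1]))
      [x, star_fun star c d F x]"
    by (rule transfer[OF ext]) (auto simp: tuples_def length_Suc_conv)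
  then show ?thesis using star_fun_graph[OF assms, of d F] by (simp add: star_set_def)
qed

lemma star_fun2_graph:
  assumes ext: "nonstandard_extension star" and c: "inj c" "inj d"
    and x: "x \<in> star_set star c UNIV" "y \<in> star_set star d UNIV"
  shows "[x, y, star_fun2 star c d e F x y] \<in> star {[c a, d b, e (F a b)] | a b. True}"
proof -
  let ?G = "{[c a, d b, e (F a b)] | a b. True}"
  have "sat star (Imp (Rel {[c a] | a. a \<in> UNIV} [0]) (Imp (Rel {[d a] | a. a \<in> UNIV} [1])
      (FEx (Rel ?G [0, 1, 2])))) [x, y]"
    by (rule transfer[OF ext]) (auto simp: tuples_def length_Suc_conv inj_eq[OF c(1)] inj_eq[OF c(2)])
  then obtain z where z: "[x, y, z] \<in> star ?G"
    using x by (auto simp: star_set_def)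
  have "w = z" if "[x, y, w] \<in> star ?G" for w
  proof -
    have "sat star (Imp (Rel ?G [0, 1, 2]) (Imp (Rel ?G [0, 1, 3]) (Eq 2 3))) [x, y, w, z]"
      by (rule transfer[OF ext]) (auto simp: tuples_def length_Suc_conv simp: inj_eq[OF c(1)] inj_eq[OF c(2)])
    then show ?thesis using that z by simp
  qed
  then show ?thesis
    unfolding star_fun2_def using z by (rule theI[of _ z, rotated])
qed

lemma star_fun2_mem:
  assumes ext: "nonstandard_extension star" and "inj c" "inj d"
    and "x \<in> star_set star c UNIV" "y \<in> star_set star d UNIV"
  shows "star_fun2 star c d e F x y \<in> star_set star e UNIV"
proof -
  have "sat star (Imp (Rel {[c a, d b, e (F a b)] | a b. True} [0, 1, 2]) (Rel {[e a] | a. a \<in> UNIV} [2]))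
      [x, y, star_fun2 star c d e F x y]"
    by (rule transfer[OF ext]) (auto simp: tuples_def length_Suc_conv)
  then show ?thesis using star_fun2_graph[OF assms, of e F] by (simp add: star_set_def)
qed

text \<open>Existence (a closed formula) and uniqueness both transfer, so the extension of a
  singleton is a singleton and the description in \<open>star_elem\<close> denotes.\<close>

lemma star_elem_mem:
  assumes ext: "nonstandard_extension star"
  shows "[star_elem star u] \<in> star {[u]}"
proof -
  have "sat star (FEx (Rel {[u]} [0])) []"
    by (rule transfer[OF ext]) (auto simp: tuples_def)
  then obtain w where w: "[w] \<in> star {[u]}" by auto
  have "v = w" if "[v] \<in> star {[u]}" for v
  proof -
    have "sat star (Imp (Rel {[u]} [0]) (Imp (Rel {[u]} [1]) (Eq 0 1))) [v, w]"
      by (rule transfer[OF ext]) (auto simp: tuples_def length_Suc_conv)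
    then show ?thesis using that w by simp
  qed
  note unique = this
  have sub: "star {[u]} \<subseteq> tuples 1"
    by (rule star_subset_tuples[OF ext]) (simp add: tuples_def)
  have eq: "star {[u]} = {[w]}"
  proof (intro equalityI subsetI)
    fix vs assume vs: "vs \<in> star {[u]}"
    then obtain v where "vs = [v]"
      using sub by (auto simp: tuples_def length_Suc_conv)
    then show "vs \<in> {[w]}" using vs unique by simp
  qed (use w in simp)
  then show ?thesis
    by (simp add: star_elem_def)
qed

lemma inj_Re: "inj Re" and inj_Pt: "inj Pt"
  by (auto simp: inj_def)

text \<open>The grid with a standard \<open>a\<close> in place of \<open>N0\<close>: an ordinary
  finite set at every real \<open>a\<close>, and a family in \<open>a\<close> to which transfer
  applies. The product \<open>z * (1 / n)\<close> repeats the form used in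
  \<open>grid\<close>.\<close>

definition std_grid :: "real \<Rightarrow> real set" where
  "std_grid a = (let n = fact (nat \<lfloor>a\<rfloor>) in (\<lambda>z. z * (1 / n)) ` {z \<in> \<int>. - (n\<^sup>2) \<le> z \<and> z \<le> n\<^sup>2})"

lemma finite_std_grid: "finite (std_grid a)"
  unfolding std_grid_def Let_def by (intro finite_imageI finite_int_segment)

text \<open>All sections at standard parameters are finite, so the section of the extension at
  \<open>N0\<close> acts as a hyperfinite set around the grid domain.\<close>

definition std_grid_rel :: "('k::finite, 'e) univ list set" where
  "std_grid_rel = {[Pt v, Re a] | v a. \<forall>i. v $ i \<in> std_grid a}"

lemma finite_std_grid_rel: "finite {u. [u, a] \<in> std_grid_rel}"
proof (cases a)
  case (Re r)
  have "{u. [u, a] \<in> std_grid_rel} \<subseteq> Pt ` vec_lambda ` (PiE UNIV (\<lambda>_. std_grid r))"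
  proof
    fix u assume "u \<in> {u. [u, a] \<in> std_grid_rel}"
    then obtain v where v: "u = Pt v" "\<And>i. v $ i \<in> std_grid r"
      by (auto simp: std_grid_rel_def Re)
    then have "v = vec_lambda (vec_nth v)" "vec_nth v \<in> PiE UNIV (\<lambda>_. std_grid r)"
      by auto
    then show "u \<in> Pt ` vec_lambda ` (PiE UNIV (\<lambda>_. std_grid r))"
      using v(1) by blast
  qed
  then show ?thesis
    by (rule finite_subset) (intro finite_imageI finite_PiE finite_std_grid finite)
qed (auto simp: std_grid_rel_def)

section \<open>Hyperreal values, standard parts, and the grid at a hypernatural parameter\<close>

context
  fixes star :: "('k::finite, 'e, 'w) star_map"
  assumes ext: "nonstandard_extension star"
begin

lemma star_set_mono:
  assumes "A \<subseteq> B" shows "star_set star c A \<subseteq> star_set star c B"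
proof
  fix x assume "x \<in> star_set star c A"
  moreover have "sat star (Imp (Rel {[c a] | a. a \<in> A} [0]) (Rel {[c a] | a. a \<in> B} [0])) [x]"
    by (rule transfer[OF ext]) (use assms in \<open>auto simp: tuples_def length_Suc_conv\<close>)
  ultimately show "x \<in> star_set star c B" by (simp add: star_set_def)
qed

lemma hypint_hypreal: "hypint star \<subseteq> hypreal star"
  and hypnat_hypreal: "hypnat star \<subseteq> hypreal star"
  unfolding hypint_def hypnat_def hypreal_def by (intro star_set_mono subset_UNIV)+

lemma hfun_graph: "x \<in> hypreal star \<Longrightarrow> [x, hfun star F x] \<in> star {[Re a, Re (F a)] | a. True}"
  and hfun_hypreal: "x \<in> hypreal star \<Longrightarrow> hfun star F x \<in> hypreal star"
  unfolding hfun_def hypreal_def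
  by (rule star_fun_graph[OF ext inj_Re] star_fun_mem[OF ext inj_Re]; assumption)+

lemma hop_graph: "x \<in> hypreal star \<Longrightarrow> y \<in> hypreal star \<Longrightarrow>
      [x, y, hop star F x y] \<in> star {[Re a, Re b, Re (F a b)] | a b. True}"
  and hop_hypreal: "x \<in> hypreal star \<Longrightarrow> y \<in> hypreal star \<Longrightarrow> hop star F x y \<in> hypreal star"
  unfolding hop_def hypreal_def
  by (rule star_fun2_graph[OF ext inj_Re inj_Re] star_fun2_mem[OF ext inj_Re inj_Re]; assumption)+

lemma hreal_mem: "[hreal star r] \<in> star {[Re r]}"
  unfolding hreal_def by (rule star_elem_mem[OF ext])

lemma hreal_hypreal: "hreal star r \<in> hypreal star"
proof -
  have "sat star (Imp (Rel {[Re r]} [0]) (Rel {[Re a] | a. a \<in> UNIV} [0])) [hreal star r]"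
    by (rule transfer[OF ext]) (auto simp: tuples_def length_Suc_conv)
  then show ?thesis using hreal_mem[of r] by (simp add: star_set_def hypreal_def)
qed

text \<open>The triangle inequality transfers. This turns two representations of one inner product
  into an equality of integrals.\<close>

lemma std_part_unique:
  assumes "has_std_part star x a" "has_std_part star x b"
  shows "a = b"
proof (rule ccontr)
  assume "a \<noteq> b"
  \<comment> \<open>Half the distance, so that the open \<open>e\<close>-neighbourhoods of
    \<open>a\<close> and \<open>b\<close> are disjoint.\<close>
  define e where "e = \<bar>a - b\<bar> / 2"
  then have "e > 0" using \<open>a \<noteq> b\<close> by simp
  have sep: False if "\<bar>t - a\<bar> < e" "\<bar>t - b\<bar> < e" for t
  proof -
    have "\<bar>a - b\<bar> \<le> \<bar>t - a\<bar> + \<bar>t - b\<bar>" by arith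
    then show ?thesis using that by (simp add: e_def)
  qed
  have x: "x \<in> hypreal star" using assms(1) by (simp add: has_std_part_def)
  define A where "A = hreal star a"
  define B where "B = hreal star b"
  define E where "E = hreal star e"
  have AB: "A \<in> hypreal star" "B \<in> hypreal star" "[A] \<in> star {[Re a]}" "[B] \<in> star {[Re b]}" "[E] \<in> star {[Re e]}"
    unfolding A_def B_def E_def by (rule hreal_hypreal hreal_mem)+
  define d1 where "d1 = hop star (-) x A"
  define d2 where "d2 = hop star (-) x B"
  define m1 where "m1 = hfun star abs d1"
  define m2 where "m2 = hfun star abs d2"
  let ?sub = "{[Re a, Re b, Re (a - b)] | a b. True}"
  let ?abs = "{[Re a, Re (\<bar>a\<bar>)] | a. True}"
  let ?less = "{[Re a, Re b] | a b. a < b}"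
  have d: "[x, A, d1] \<in> star ?sub" "[x, B, d2] \<in> star ?sub" "d1 \<in> hypreal star" "d2 \<in> hypreal star"
    unfolding d1_def d2_def by (rule hop_graph hop_hypreal x AB)+
  have m: "[d1, m1] \<in> star ?abs" "[d2, m2] \<in> star ?abs"
    unfolding m1_def m2_def by (rule hfun_graph d)+
  have l: "[m1, E] \<in> star ?less" "[m2, E] \<in> star ?less"
    using assms \<open>e > 0\<close> unfolding m1_def m2_def d1_def d2_def A_def B_def E_def
    by (auto simp: has_std_part_def hless_def)
  have "sat star (Imp (Rel {[Re a]} [1]) (Imp (Rel {[Re b]} [2]) (Imp (Rel {[Re e]} [3])
      (Imp (Rel ?sub [0, 1, 4]) (Imp (Rel ?sub [0, 2, 5]) (Imp (Rel ?abs [4, 6]) (Imp (Rel ?abs [5, 7])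
      (Imp (Rel ?less [6, 3]) (Neg (Rel ?less [7, 3])))))))))) [x, A, B, E, d1, d2, m1, m2]"
    by (rule transfer[OF ext]) (auto simp: tuples_def length_Suc_conv dest: sep)
  then show False
    using AB d m l by simp
qed

text \<open>Agreement on \<open>[-r, r]\<close> is a standard statement about all points of that
  interval, so it transfers to all hyperreals bounded by \<open>r\<close>.\<close>

lemma hfun_eq_if_bounded:
  assumes x: "x \<in> hypreal star" and le: "hle star (hfun star abs x) (hreal star r)"
    and eq: "\<And>t. \<bar>t\<bar> \<le> r \<Longrightarrow> F t = G t"
  shows "hfun star F x = hfun star G x"
proof -
  let ?abs = "{[Re a, Re (\<bar>a\<bar>)] | a. True}"
  have "sat star (Imp (Rel {[Re r]} [2]) (Imp (Rel ?abs [0, 1]) (Imp (Rel {[Re a, Re b] | a b. a \<le> b} [1, 2])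
      (Imp (Rel {[Re a, Re (F a)] | a. True} [0, 3]) (Imp (Rel {[Re a, Re (G a)] | a. True} [0, 4]) (Eq 3 4))))))
      [x, hfun star abs x, hreal star r, hfun star F x, hfun star G x]"
    by (rule transfer[OF ext]) (auto simp: tuples_def length_Suc_conv eq)
  then show ?thesis
    using hreal_mem[of r] hfun_graph[OF x, of abs] hfun_graph[OF x, of F] hfun_graph[OF x, of G] le
    by (simp add: hle_def)
qed

lemma hfun_id:
  assumes x: "x \<in> hypreal star" shows "hfun star (\<lambda>t. t) x = x"
proof -
  have "sat star (Imp (Rel {[Re a, Re a] | a. True} [0, 1]) (Eq 1 0)) [x, hfun star (\<lambda>t. t) x]"
    by (rule transfer[OF ext]) (auto simp: tuples_def length_Suc_conv)
  then show ?thesis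
    using hfun_graph[OF x, of "\<lambda>t. t"] by simp
qed

lemma hle_antisym:
  assumes "hle star x y" "hle star y x" shows "x = y"
proof -
  let ?le = "{[Re a, Re b] | a b. a \<le> b}"
  have "sat star (Imp (Rel ?le [0, 1]) (Imp (Rel ?le [1, 0]) (Eq 0 1))) [x, y]"
    by (rule transfer[OF ext]) (auto simp: tuples_def length_Suc_conv)
  then show ?thesis using assms by (simp add: hle_def)
qed

text \<open>Meant for \<open>y\<close> the maximum of a grid function: finiteness bounds the
  absolute value of \<open>y\<close>, while a bound on everything below \<open>y\<close> is
  wanted.\<close>

lemma hle_abs_trans:
  assumes "hle star x y" "y \<in> hypreal star" "hle star (hfun star abs y) z" shows "hle star x z"
proof -
  let ?le = "{[Re a, Re b] | a b. a \<le> b}"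
  have "sat star (Imp (Rel ?le [0, 1]) (Imp (Rel {[Re a, Re (\<bar>a\<bar>)] | a. True} [1, 2])
      (Imp (Rel ?le [2, 3]) (Rel ?le [0, 3])))) [x, y, hfun star abs y, z]"
    by (rule transfer[OF ext]) (auto simp: tuples_def length_Suc_conv)
  then show ?thesis using assms hfun_graph[OF assms(2), of abs] by (simp add: hle_def)
qed

lemma grid_subset:
  assumes N0: "N0 \<in> hypnat star" and x: "x \<in> grid star N0"
  shows "[x, N0] \<in> star {[Re b, Re a] | a b. b \<in> std_grid a}"
proof -
  let ?F = "\<lambda>a. fact (nat \<lfloor>a\<rfloor>)"
  let ?le = "{[Re a, Re b] | a b. a \<le> b}"
  define N where "N = hfun star ?F N0"
  define n1 where "n1 = hfun star (\<lambda>a. - (a\<^sup>2)) N"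
  define n2 where "n2 = hfun star (\<lambda>a. a\<^sup>2) N"
  define one where "one = hreal star 1"
  define e where "e = hop star (/) one N"
  obtain n where n: "x = hop star (*) n e" "n \<in> hypint star" "hle star n1 n" "hle star n n2"
    using x unfolding grid_def grid_eps_def grid_N_def N_def n1_def n2_def one_def e_def by auto
  have one: "[one] \<in> star {[Re 1]}" "one \<in> hypreal star"
    unfolding one_def by (rule hreal_hypreal hreal_mem)+
  have N0': "N0 \<in> hypreal star" using N0 hypnat_hypreal by auto
  have N: "[N0, N] \<in> star {[Re a, Re (?F a)] | a. True}" "N \<in> hypreal star"
    unfolding N_def using N0' by (rule hfun_graph hfun_hypreal)+
  have n12: "[N, n1] \<in> star {[Re a, Re (- (a\<^sup>2))] | a. True}" "[N, n2] \<in> star {[Re a, Re (a\<^sup>2)] | a. True}"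
    unfolding n1_def n2_def using N(2) by (rule hfun_graph)+
  have e: "[one, N, e] \<in> star {[Re a, Re b, Re (a / b)] | a b. True}" "e \<in> hypreal star"
    unfolding e_def by (rule hop_graph hop_hypreal one N)+
  have n': "n \<in> hypreal star" using n(2) hypint_hypreal by auto
  have xg: "[n, e, x] \<in> star {[Re a, Re b, Re (a * b)] | a b. True}"
    unfolding n(1) using n' e(2) by (rule hop_graph)
  \<comment> \<open>Every intermediate value in the construction of the grid is a variable of one
    formula, whose standard reading is the definition of \<open>std_grid\<close>.\<close>
  have "sat star (Imp (Rel {[Re a, Re (?F a)] | a. True} [1, 2])
      (Imp (Rel {[Re a, Re (- (a\<^sup>2))] | a. True} [2, 3])
      (Imp (Rel {[Re a, Re (a\<^sup>2)] | a. True} [2, 4])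
      (Imp (Rel {[Re 1]} [5])
      (Imp (Rel {[Re a, Re b, Re (a / b)] | a b. True} [5, 2, 6])
      (Imp (Rel {[Re a] | a. a \<in> \<int>} [7])
      (Imp (Rel ?le [3, 7])
      (Imp (Rel ?le [7, 4])
      (Imp (Rel {[Re a, Re b, Re (a * b)] | a b. True} [7, 6, 0])
      (Rel {[Re b, Re a] | a b. b \<in> std_grid a} [0, 1]))))))))))
      [x, N0, N, n1, n2, one, e, n]"
    by (rule transfer[OF ext]) (auto simp: tuples_def length_Suc_conv std_grid_def Let_def)
  then show ?thesis
    using n N n12 one e xg by (simp add: hle_def hypint_def star_set_def)
qed

text \<open>Membership is checked coordinate by coordinate; there are finitely many coordinates, so
  the extension commutes with the intersection of their conditions.\<close>

lemma grid_dom_subset: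
  assumes N0: "N0 \<in> hypnat star" and x: "x \<in> grid_dom star N0 \<Omega>"
  shows "[x, N0] \<in> star std_grid_rel"
proof -
  have x': "x \<in> star_set star Pt UNIV"
    using x star_set_mono[of \<Omega> UNIV] by (auto simp: grid_dom_def)
  let ?R = "\<lambda>i. {[Pt v, Re a] | v a. v $ i \<in> std_grid a}"
  have "[x, N0] \<in> star (?R i)" for i
  proof -
    let ?y = "star_fun star Pt Re (\<lambda>v. v $ i) x"
    have "sat star (Imp (Rel {[Pt v, Re (v $ i)] | v. True} [0, 1])
        (Imp (Rel {[Re b, Re a] | a b. b \<in> std_grid a} [1, 2]) (Rel (?R i) [0, 2]))) [x, ?y, N0]"
      by (rule transfer[OF ext]) (auto simp: tuples_def length_Suc_conv)
    moreover have "[?y, N0] \<in> star {[Re b, Re a] | a b. b \<in> std_grid a}"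
      using x by (intro grid_subset N0) (auto simp: grid_dom_def)
    ultimately show ?thesis
      using star_fun_graph[OF ext inj_Pt x', of Re "\<lambda>v. v $ i"] by simp
  qed
  then have "[x, N0] \<in> tuples 2 \<inter> (\<Inter>i\<in>UNIV. star (?R i))"
    by (simp add: tuples_def)
  also have "\<dots> = star (tuples 2 \<inter> (\<Inter>i\<in>UNIV. ?R i))"
    by (rule star_INT[OF ext, symmetric]) (auto simp: tuples_def)
  also have "tuples 2 \<inter> (\<Inter>i\<in>UNIV. ?R i) = std_grid_rel"
  proof (intro equalityI subsetI)
    fix xs assume "xs \<in> tuples 2 \<inter> (\<Inter>i\<in>UNIV. ?R i)"
    then have xs: "xs \<in> ?R i" for i by blast
    \<comment> \<open>Any index will do: it fixes the shape of \<open>xs\<close>, and injectivity of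
      the constructors gives the same \<open>v\<close> and \<open>a\<close> at the others.\<close>
    from xs[of undefined] obtain v a where "xs = [Pt v, Re a]" by blast
    then show "xs \<in> std_grid_rel" using xs by (auto simp: std_grid_rel_def)
  qed (auto simp: std_grid_rel_def tuples_def)
  finally show ?thesis .
qed

end

section \<open>Boundedness of grid functions\<close>

text \<open>The standard fact behind \<open>max_fm\<close>: a finite domain and single values leave
  finitely many absolute values to compare.\<close>

lemma finite_graph_max:
  fixes R :: "('k::finite, 'e) univ \<Rightarrow> ('k, 'e) univ \<Rightarrow> bool"
  assumes fin: "finite {u. \<exists>y. R u y}" and fn: "\<And>u y z. R u y \<Longrightarrow> R u z \<Longrightarrow> y = z"
    and re: "\<And>u y. R u y \<Longrightarrow> \<exists>a. y = Re a" and ne: "R u0 y0"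
  shows "\<exists>u y. R u y \<and> (\<forall>v z. R v z \<longrightarrow> (\<exists>a b. z = Re a \<and> y = Re b \<and> \<bar>a\<bar> \<le> \<bar>b\<bar>))"
proof -
  define val where "val u = (THE a. R u (Re a))" for u
  let ?X = "{u. \<exists>y. R u y}"
  have val: "y = Re (val u)" if Ruy: "R u y" for u y
  proof -
    obtain a where a: "y = Re a" using re Ruy by blast
    have "val u = a" unfolding val_def
      using Ruy a fn by (intro the_equality) (auto dest: fn)
    then show ?thesis using a by simp
  qed
  let ?V = "(\<lambda>u. \<bar>val u\<bar>) ` ?X"
  have "Max ?V \<in> ?V" using fin ne by (intro Max_in) auto
  then obtain u y where u: "R u y" "Max ?V = \<bar>val u\<bar>" by auto
  have "\<bar>val v\<bar> \<le> \<bar>val u\<bar>" if "R v z" for v z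
    using that fin unfolding u(2)[symmetric] by (intro Max_ge) auto
  then show ?thesis
    using u(1) val by blast
qed

text \<open>The formula says: if the section \<open>{(x, y). [x, y] @ ps \<in> R}\<close> is a nonempty graph of a real-valued
  function whose domain lies in the section of \<open>D\<close> at the variable \<open>0\<close>, then the absolute value of
  that function attains its maximum. The \<open>n\<close> parameters \<open>ps\<close> are the variables \<open>1, ..., n\<close>.\<close>

definition max_fm :: "nat \<Rightarrow> ('k::finite, 'e) univ list set \<Rightarrow> ('k, 'e) univ list set \<Rightarrow> ('k, 'e) univ fm" where
  "max_fm n D R =
    (let ps = [1..<Suc n]; x = Suc n; y = n + 2; z = n + 3; w = n + 4 in
     Imp (FAll (FAll (Imp (Rel R (x # y # ps)) (Rel D [x, 0]))))
    (Imp (FAll (FAll (FAll (Imp (Rel R (x # y # ps)) (Imp (Rel R (x # z # ps)) (Eq y z))))))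
    (Imp (FAll (FAll (Imp (Rel R (x # y # ps)) (Rel {[Re a] | a. a \<in> UNIV} [y]))))
    (Imp (FEx (FEx (Rel R (x # y # ps))))
         (FEx (FEx (Con (Rel R (x # y # ps))
            (FAll (FAll (Imp (Rel R (z # w # ps)) (Rel {[Re a, Re b] | a b. \<bar>a\<bar> \<le> \<bar>b\<bar>} [w, y])))))))))))"

lemma map_nth_Cons_append:
  "length ps = n \<Longrightarrow> map ((!) (a # ps @ zs)) [Suc 0..<Suc n] = ps"
  unfolding map_Suc_upt[symmetric] map_map
  by (rule nth_equalityI) (auto simp: nth_append)

text \<open>For any interpretation \<open>I\<close>, so that the formula can be read both at
  \<open>id\<close> and at \<open>star\<close>.\<close>

lemma sat_max_fm:
  assumes "length ps = n"
  shows "sat I (max_fm n D R) (a # ps) \<longleftrightarrow>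
    ((\<forall>u y. u # y # ps \<in> I R \<longrightarrow> [u, a] \<in> I D) \<longrightarrow>
     (\<forall>u y z. u # y # ps \<in> I R \<longrightarrow> u # z # ps \<in> I R \<longrightarrow> y = z) \<longrightarrow>
     (\<forall>u y. u # y # ps \<in> I R \<longrightarrow> [y] \<in> I {[Re a] | a. a \<in> UNIV}) \<longrightarrow>
     (\<exists>u y. u # y # ps \<in> I R) \<longrightarrow>
     (\<exists>u y. u # y # ps \<in> I R \<and>
        (\<forall>v z. v # z # ps \<in> I R \<longrightarrow> [z, y] \<in> I {[Re a, Re b] | a b. \<bar>a\<bar> \<le> \<bar>b\<bar>})))"
  using assms unfolding max_fm_def Let_def
  by (simp add: map_nth_Cons_append nth_append del: upt_Suc)

text \<open>At standard parameters the domain lies in a finite section of \<open>D\<close>, hence a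
  maximum exists. \<open>N0\<close> and the internal parameters \<open>ps\<close> are free variables
  of \<open>max_fm\<close>, so the standard statement covers every choice of them and
  transfers.\<close>

lemma internal_graph_max:
  fixes star :: "('k::finite, 'e, 'w) star_map"
  assumes ext: "nonstandard_extension star"
    and D: "D \<subseteq> tuples 2" "\<And>a. finite {u. [u, a] \<in> D}"
    and R: "R \<subseteq> tuples (2 + length ps)"
    and sub: "\<And>x y. x # y # ps \<in> star R \<Longrightarrow> [x, N0] \<in> star D"
    and fn: "\<And>x y z. x # y # ps \<in> star R \<Longrightarrow> x # z # ps \<in> star R \<Longrightarrow> y = z"
    and re: "\<And>x y. x # y # ps \<in> star R \<Longrightarrow> y \<in> hypreal star"
    and ne: "x0 # y0 # ps \<in> star R"
  shows "\<exists>x y. x # y # ps \<in> star R \<and>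
    (\<forall>v z. v # z # ps \<in> star R \<longrightarrow> hle star (hfun star abs z) (hfun star abs y))"
proof -
  have std: "sat id (max_fm (length ps) D R) xs" if len: "length xs = Suc (length ps)" for xs
  proof -
    obtain a qs where xs: "xs = a # qs" "length qs = length ps"
      using len by (cases xs) auto
    show ?thesis
      unfolding xs(1) sat_max_fm[OF xs(2)]
    proof (intro impI)
      assume 1: "\<forall>u y. u # y # qs \<in> id R \<longrightarrow> [u, a] \<in> id D"
        and 2: "\<forall>u y z. u # y # qs \<in> id R \<longrightarrow> u # z # qs \<in> id R \<longrightarrow> y = z"
        and 3: "\<forall>u y. u # y # qs \<in> id R \<longrightarrow> [y] \<in> id {[Re a] | a. a \<in> UNIV}"
        and 4: "\<exists>u y. u # y # qs \<in> id R"
      have "{u. \<exists>y. u # y # qs \<in> R} \<subseteq> {u. [u, a] \<in> D}"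
        using 1 by auto
      then have "finite {u. \<exists>y. u # y # qs \<in> R}"
        using D(2) by (rule finite_subset)
      moreover obtain u0 y0 where "u0 # y0 # qs \<in> R" using 4 by auto
      ultimately have "\<exists>u y. u # y # qs \<in> R \<and>
          (\<forall>v z. v # z # qs \<in> R \<longrightarrow> (\<exists>a b. z = Re a \<and> y = Re b \<and> \<bar>a\<bar> \<le> \<bar>b\<bar>))"
        using 2 3 by (intro finite_graph_max[of "\<lambda>u y. u # y # qs \<in> R"]) auto
      then show "\<exists>u y. u # y # qs \<in> id R \<and>
          (\<forall>v z. v # z # qs \<in> id R \<longrightarrow> [z, y] \<in> id {[Re a, Re b] | a b. \<bar>a\<bar> \<le> \<bar>b\<bar>})"
        by auto
    qed
  qed
  have "sat star (max_fm (length ps) D R) (N0 # ps)"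
    by (rule transfer[OF ext _ std]) (use D(1) R in \<open>auto simp: max_fm_def Let_def tuples_def simp del: upt_Suc\<close>)
  then obtain x y where xy: "x # y # ps \<in> star R"
      "\<And>v z. v # z # ps \<in> star R \<Longrightarrow> [z, y] \<in> star {[Re a, Re b] | a b. \<bar>a\<bar> \<le> \<bar>b\<bar>}"
    unfolding sat_max_fm[OF refl] using sub fn re ne unfolding hypreal_def star_set_def by blast
  have "hle star (hfun star abs z) (hfun star abs y)" if vz: "v # z # ps \<in> star R" for v z
  proof -
    let ?abs = "{[Re a, Re (\<bar>a\<bar>)] | a. True}"
    have "sat star (Imp (Rel {[Re a, Re b] | a b. \<bar>a\<bar> \<le> \<bar>b\<bar>} [0, 1]) (Imp (Rel ?abs [0, 2]) (Imp (Rel ?abs [1, 3])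
        (Rel {[Re a, Re b] | a b. a \<le> b} [2, 3])))) [z, y, hfun star abs z, hfun star abs y]"
      by (rule transfer[OF ext]) (auto simp: tuples_def length_Suc_conv)
    then show ?thesis
      using xy(2)[OF vz] hfun_graph[OF ext re[OF vz], of abs] hfun_graph[OF ext re[OF xy(1)], of abs]
      by (simp add: hle_def)
  qed
  then show ?thesis using xy(1) by blast
qed

lemma grid_function_bounded:
  fixes star :: "('k::finite, 'e, 'w) star_map"
  assumes ext: "nonstandard_extension star"
    and N0: "N0 \<in> hypnat star" and f: "f \<in> grid_functions star N0 \<Omega>"
    and fin: "hfinite star (grid_norm_inf star N0 \<Omega> f)"
  obtains r where "\<And>x. x \<in> grid_dom star N0 \<Omega> \<Longrightarrow> hle star (hfun star abs (f x)) (hreal star r)"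
proof (cases "grid_dom star N0 \<Omega> = {}")
  case True
  then show ?thesis using that by auto
next
  case False
  let ?G = "grid_dom star N0 \<Omega>"
  have re: "f x \<in> hypreal star" if "x \<in> ?G" for x
    using f that by (auto simp: grid_functions_def)
  \<comment> \<open>Internality presents the graph of \<open>f\<close> as a section of some
    \<open>star R\<close>, the shape that \<open>max_fm\<close> speaks of.\<close>
  obtain R ps where R: "R \<subseteq> tuples (2 + length ps)"
      and eq: "{[x, f x] | x. x \<in> ?G} = {xs \<in> tuples 2. xs @ ps \<in> star R}"
    using f unfolding grid_functions_def internal_set_def by blast
  have R_iff: "x # y # ps \<in> star R \<longleftrightarrow> x \<in> ?G \<and> y = f x" for x y
  proof -
    have "x # y # ps \<in> star R \<longleftrightarrow> [x, y] \<in> {xs \<in> tuples 2. xs @ ps \<in> star R}"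
      by (simp add: tuples_def)
    also have "\<dots> \<longleftrightarrow> x \<in> ?G \<and> y = f x"
      unfolding eq[symmetric] by auto
    finally show ?thesis .
  qed
  obtain x0 where x0: "x0 \<in> ?G" using False by auto
  have "\<exists>x y. x # y # ps \<in> star R \<and>
      (\<forall>v z. v # z # ps \<in> star R \<longrightarrow> hle star (hfun star abs z) (hfun star abs y))"
  proof (rule internal_graph_max[OF ext _ _ R])
    show "std_grid_rel \<subseteq> tuples 2"
      by (auto simp: std_grid_rel_def tuples_def)
    show "finite {u. [u, a] \<in> std_grid_rel}" for a
      by (rule finite_std_grid_rel)
    show "[x, N0] \<in> star std_grid_rel" if "x # y # ps \<in> star R" for x y
      using that by (intro grid_dom_subset[OF ext N0, of _ \<Omega>]) (simp add: R_iff)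
    show "x0 # f x0 # ps \<in> star R" using x0 by (simp add: R_iff)
  qed (auto simp: R_iff re)
  then obtain u where u: "u \<in> ?G" "\<And>x. x \<in> ?G \<Longrightarrow> hle star (hfun star abs (f x)) (hfun star abs (f u))"
    by (auto simp: R_iff)
  \<comment> \<open>Antisymmetry makes the maximum unique, so the description in the norm denotes
    the value attained at \<open>u\<close>.\<close>
  have "grid_norm_inf star N0 \<Omega> f = hfun star abs (f u)"
    unfolding grid_norm_inf_def if_not_P[OF False]
  proof (rule the_equality)
    fix m assume "(\<exists>x\<in>?G. m = hfun star abs (f x)) \<and> (\<forall>x\<in>?G. hle star (hfun star abs (f x)) m)"
    then show "m = hfun star abs (f u)"
      using u by (auto intro: hle_antisym[OF ext])
  qed (use u in auto)
  then obtain r where "hle star (hfun star abs (hfun star abs (f u))) (hreal star r)"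
    using fin by (auto simp: hfinite_def)
  then have "hle star (hfun star abs (f x)) (hreal star r)" if "x \<in> ?G" for x
    using u that re by (blast intro: hle_abs_trans[OF ext] hfun_hypreal[OF ext])
  then show ?thesis by (rule that)
qed

text \<open>The hyperfinite sum sees its summand only through the graph over the grid domain, so
  both sums have literally the same description.\<close>

lemma grid_inner_cong:
  assumes "\<And>x. x \<in> grid_dom star N0 \<Omega> \<Longrightarrow> f x = g x"
  shows "grid_inner star N0 \<Omega> f \<phi> = grid_inner star N0 \<Omega> g \<phi>"
proof -
  have "(x \<in> grid_dom star N0 \<Omega> \<and> y = hop star (*) (f x) (\<phi> x)) \<longleftrightarrow>
      (x \<in> grid_dom star N0 \<Omega> \<and> y = hop star (*) (g x) (\<phi> x))" for x y
    using assms by auto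
  then show ?thesis
    unfolding grid_inner_def hsum_def by simp
qed

lemma grid_inner_hfun_cong:
  fixes star :: "('k::finite, 'e, 'w) star_map" and \<Omega> :: "(real^'k) set"
  assumes ext: "nonstandard_extension star"
    and N0: "N0 \<in> hypnat star" and f: "f \<in> grid_functions star N0 \<Omega>"
    and fin: "hfinite star (grid_norm_inf star N0 \<Omega> f)"
  obtains r where "r \<ge> 0"
    "\<And>F G \<phi>. (\<And>t. \<bar>t\<bar> \<le> r \<Longrightarrow> F t = G t) \<Longrightarrow>
      grid_inner star N0 \<Omega> (\<lambda>x. hfun star F (f x)) \<phi> = grid_inner star N0 \<Omega> (\<lambda>x. hfun star G (f x)) \<phi>"
    "\<And>F \<phi>. (\<And>t. \<bar>t\<bar> \<le> r \<Longrightarrow> F t = t) \<Longrightarrow>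
      grid_inner star N0 \<Omega> (\<lambda>x. hfun star F (f x)) \<phi> = grid_inner star N0 \<Omega> f \<phi>"
proof -
  obtain r where r: "\<And>x. x \<in> grid_dom star N0 \<Omega> \<Longrightarrow> hle star (hfun star abs (f x)) (hreal star r)"
    using grid_function_bounded[OF assms] by blast
  have re: "f x \<in> hypreal star" if "x \<in> grid_dom star N0 \<Omega>" for x
    using f that by (auto simp: grid_functions_def)
  have cong: "hfun star F (f x) = hfun star G (f x)"
    if "\<And>t. \<bar>t\<bar> \<le> max 0 r \<Longrightarrow> F t = G t" "x \<in> grid_dom star N0 \<Omega>" for F G x
    by (rule hfun_eq_if_bounded[OF ext re r]) (use that in auto)
  show ?thesis
  \<comment> \<open>On an empty grid the bound may be negative, and the truncations below take a
    nonnegative radius.\<close>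
  proof (rule that[of "max 0 r"])
    show "grid_inner star N0 \<Omega> (\<lambda>x. hfun star F (f x)) \<phi> = grid_inner star N0 \<Omega> f \<phi>"
      if "\<And>t. \<bar>t\<bar> \<le> max 0 r \<Longrightarrow> F t = t" for F \<phi>
      using cong[of F "\<lambda>t. t"] that re by (intro grid_inner_cong) (simp add: hfun_id[OF ext])
  qed (auto intro: grid_inner_cong cong)
qed

section \<open>Young measures\<close>

text \<open>Testing against a tent function on a ball gives a nonnegative integrand with integral
  zero, so \<open>g\<close> vanishes a.e. on that ball; countably many such balls cover
  \<open>\<Omega>\<close>.\<close>

lemma AE_zero_if_orthogonal_C0c:
  fixes g :: "real^'k::finite \<Rightarrow> real"
  assumes "open \<Omega>" and g: "g \<in> borel_measurable (lebesgue_on \<Omega>)"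
    and bounds: "\<And>x. x \<in> \<Omega> \<Longrightarrow> 0 \<le> g x" "\<And>x. x \<in> \<Omega> \<Longrightarrow> g x \<le> B"
    and zero: "\<And>\<phi>. \<phi> \<in> C0c \<Omega> \<Longrightarrow> (LINT x|lebesgue_on \<Omega>. g x * \<phi> x) = 0"
  shows "AE x in lebesgue_on \<Omega>. g x = 0"
proof -
  let ?M = "lebesgue_on \<Omega>"
  have \<Omega>: "\<Omega> \<in> sets lebesgue" using assms(1) by (simp add: borel_open)
  have local: "AE x in ?M. x \<in> ball c d \<longrightarrow> g x = 0" if "d > 0" "cball c d \<subseteq> \<Omega>" for c d
  proof -
    \<comment> \<open>A tent that is positive exactly on the open ball, with support in the closed
      ball and therefore in \<open>\<Omega>\<close>.\<close>
    define \<phi> where "\<phi> x = max 0 (d - dist c x)" for x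
    have supp: "closure {x. \<phi> x \<noteq> 0} \<subseteq> cball c d"
      by (rule closure_minimal) (auto simp: \<phi>_def)
    have cont: "continuous_on UNIV \<phi>"
      unfolding \<phi>_def by (intro continuous_intros)
    have "compact (closure {x. \<phi> x \<noteq> 0})"
      using bounded_subset[OF bounded_cball supp] by (simp add: compact_eq_bounded_closed)
    then have C: "\<phi> \<in> C0c \<Omega>"
      using supp that cont by (auto simp: C0c_def compact_support_in_def)
    have \<phi>: "\<phi> \<in> borel_measurable ?M"
      using continuous_on_subset[OF cont] \<Omega> by (intro continuous_imp_measurable_on_sets_lebesgue) auto
    have "cball c d \<in> sets ?M"
      using that by (simp add: sets_restrict_space_iff \<Omega> borel_closed)
    moreover have "emeasure ?M (cball c d) < \<infinity>"
      using that emeasure_lborel_cball_finite[of c d] by (simp add: emeasure_restrict_space \<Omega> borel_closed)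
    ultimately have ind: "integrable ?M (\<lambda>x. B * d * indicator (cball c d) x)"
      by (intro integrable_mult_right integrable_real_indicator)
    \<comment> \<open>Integrability has to come first: the integral of a nonintegrable function is
      \<open>0\<close> by convention and would say nothing about \<open>g\<close>.\<close>
    have int: "integrable ?M (\<lambda>x. g x * \<phi> x)"
    proof (rule Bochner_Integration.integrable_bound[OF ind])
      show "(\<lambda>x. g x * \<phi> x) \<in> borel_measurable ?M" using g \<phi> by measurable
      show "AE x in ?M. norm (g x * \<phi> x) \<le> norm (B * d * indicator (cball c d) x)"
      proof (rule AE_I2)
        fix x assume "x \<in> space ?M"
        then have "x \<in> \<Omega>" by (simp add: space_restrict_space)
        then have b: "0 \<le> g x" "g x \<le> B" "\<bar>g x\<bar> \<le> \<bar>B\<bar>" using bounds[of x] by auto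
        show "norm (g x * \<phi> x) \<le> norm (B * d * indicator (cball c d) x)"
        proof (cases "x \<in> cball c d")
          case True
          then have "\<bar>\<phi> x\<bar> \<le> \<bar>d\<bar>"
            using zero_le_dist[of c x] unfolding \<phi>_def mem_cball by linarith
          then show ?thesis using True b(3) by (auto simp: abs_mult intro!: mult_mono)
        next
          case False
          then have "\<phi> x = 0" by (auto simp: \<phi>_def)
          then show ?thesis by simp
        qed
      qed
    qed
    have nonneg: "AE x in ?M. 0 \<le> g x * \<phi> x"
      by (rule AE_I2) (auto simp: space_restrict_space \<phi>_def bounds)
    have "AE x in ?M. g x * \<phi> x = 0"
      using zero[OF C] integral_nonneg_eq_0_iff_AE[OF int nonneg] by simp
    then show ?thesis
      by eventually_elim (auto simp: \<phi>_def max_def)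
  qed
  let ?F = "{ball c d | c d. d > 0 \<and> cball c d \<subseteq> \<Omega>}"
  \<comment> \<open>A null set is discarded for each ball, so the cover must be countable.\<close>
  obtain F where F: "F \<subseteq> ?F" "countable F" "\<Union>F = \<Union>?F"
    by (rule Lindelof[of ?F]) auto
  have ae: "AE x in ?M. \<forall>S\<in>F. x \<in> S \<longrightarrow> g x = 0"
    using F(1,2) local by (intro AE_ball_countable') auto
  have cover: "x \<in> \<Union>F" if x: "x \<in> \<Omega>" for x
  proof -
    obtain e where "e > 0" "cball x e \<subseteq> \<Omega>"
      using \<open>open \<Omega>\<close> x by (auto simp: open_contains_cball)
    then have "x \<in> ball x e" "ball x e \<in> ?F" by auto
    then show ?thesis unfolding F(3) by blast
  qed
  show ?thesis
    using ae AE_space by eventually_elim (use cover in \<open>auto simp: space_restrict_space\<close>)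
qed

section \<open>Truncations and tails vanishing at infinity\<close>

lemma C0b_I:
  assumes cont: "continuous_on UNIV F" and bd: "\<And>t. \<bar>F t\<bar> \<le> B"
    and le: "\<forall>\<^sub>F t in at_infinity. \<bar>F t\<bar> \<le> inverse (1 + \<bar>t\<bar>)"
  shows "F \<in> C0b"
proof -
  have "filterlim (\<lambda>t::real. 1 + \<bar>t\<bar>) at_top at_infinity"
    using filterlim_tendsto_add_at_top[OF tendsto_const filterlim_norm_at_top[where 'a = real], of 1]
    by simp
  then have "((\<lambda>t::real. inverse (1 + \<bar>t\<bar>)) \<longlongrightarrow> 0) at_infinity"
    by (rule tendsto_inverse_0_at_top)
  then have "(F \<longlongrightarrow> 0) at_infinity"
    using le by (intro Lim_null_comparison[of F "\<lambda>t. inverse (1 + \<bar>t\<bar>)"]) auto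
  moreover have "bounded (range F)"
    using bd by (auto simp: bounded_iff)
  ultimately show ?thesis using cont by (simp add: C0b_def)
qed

text \<open>The second factor is a trapezoid, \<open>1\<close> on \<open>[-r, r]\<close> and
  \<open>0\<close> beyond distance \<open>r + 1\<close>. Clamping the first factor keeps the product
  within \<open>[-r, r]\<close> when \<open>r\<close> is nonnegative.\<close>

definition cutoff :: "real \<Rightarrow> real \<Rightarrow> real" where
  "cutoff r t = max (- r) (min r t) * max 0 (min 1 (r + 1 - \<bar>t\<bar>))"

lemma cutoff_eq: "\<bar>t\<bar> \<le> r \<Longrightarrow> cutoff r t = t"
  by (auto simp: cutoff_def)

lemma abs_cutoff_le: "0 \<le> r \<Longrightarrow> \<bar>cutoff r t\<bar> \<le> r"
proof -
  assume "0 \<le> r"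
  then have "\<bar>max (- r) (min r t)\<bar> * \<bar>max 0 (min 1 (r + 1 - \<bar>t\<bar>))\<bar> \<le> r * 1"
    by (intro mult_mono) auto
  then show ?thesis by (simp add: cutoff_def abs_mult)
qed

lemma cutoff_C0b: "0 \<le> r \<Longrightarrow> cutoff r \<in> C0b"
proof (rule C0b_I)
  show "continuous_on UNIV (cutoff r)"
    unfolding cutoff_def by (intro continuous_intros)
  have "\<forall>\<^sub>F t::real in at_infinity. r + 1 \<le> norm t"
    unfolding eventually_at_infinity by blast
  then show "\<forall>\<^sub>F t in at_infinity. \<bar>cutoff r t\<bar> \<le> inverse (1 + \<bar>t\<bar>)"
    by eventually_elim (auto simp: cutoff_def)
qed (rule abs_cutoff_le)

text \<open>Vanishes on \<open>[-r, r]\<close> and is positive elsewhere; the minimum with the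
  inverse forces decay at infinity.\<close>

definition tail :: "real \<Rightarrow> real \<Rightarrow> real" where
  "tail r t = max 0 (min (\<bar>t\<bar> - r) (inverse (1 + \<bar>t\<bar>)))"

lemma tail_eq_0_iff: "tail r t = 0 \<longleftrightarrow> \<bar>t\<bar> \<le> r"
proof -
  have "inverse (1 + \<bar>t\<bar>) > 0" by simp
  then show ?thesis unfolding tail_def by linarith
qed

lemma tail_bounds: "0 \<le> tail r t" "tail r t \<le> inverse (1 + \<bar>t\<bar>)" "tail r t \<le> 1"
proof -
  show "0 \<le> tail r t" "tail r t \<le> inverse (1 + \<bar>t\<bar>)" by (auto simp: tail_def)
  moreover have "inverse (1 + \<bar>t\<bar>) \<le> 1" by (simp add: inverse_le_1_iff)
  ultimately show "tail r t \<le> 1" by linarith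
qed

lemma tail_C0b: "tail r \<in> C0b"
proof (rule C0b_I)
  show "continuous_on UNIV (tail r)"
    unfolding tail_def by (intro continuous_intros) (auto simp: add_nonneg_eq_0_iff)
  show "\<bar>tail r t\<bar> \<le> 1" for t
    using tail_bounds[of r t] by simp
  show "\<forall>\<^sub>F t in at_infinity. \<bar>tail r t\<bar> \<le> inverse (1 + \<bar>t\<bar>)"
    using tail_bounds[of r] by (intro always_eventually allI) simp
qed

lemma C0b_borel_measurable: "F \<in> C0b \<Longrightarrow> F \<in> borel_measurable borel"
  by (auto simp: C0b_def intro: borel_measurable_continuous_onI)

lemma zero_C0b: "(\<lambda>_. 0) \<in> C0b"
  by (auto simp: C0b_def)

section \<open>Integrals against a Young measure\<close>

context
  fixes \<Omega> :: "(real^'k::finite) set" and \<nu> :: "real^'k \<Rightarrow> real measure"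
  assumes open_\<Omega>: "open \<Omega>" and young: "young_measure \<Omega> \<nu>"
begin

lemma young_prob_space: "x \<in> \<Omega> \<Longrightarrow> prob_space (\<nu> x)"
  and sets_young: "x \<in> \<Omega> \<Longrightarrow> sets (\<nu> x) = sets borel"
proof -
  assume "x \<in> \<Omega>"
  then have "\<nu> x \<in> space (prob_algebra borel)"
    using young measurable_space[of \<nu> "lebesgue_on \<Omega>" "prob_algebra borel" x]
    by (simp add: young_measure_def space_restrict_space)
  then show "prob_space (\<nu> x)" "sets (\<nu> x) = sets borel"
    by (simp_all add: space_prob_algebra)
qed

lemma young_borel_measurable:
  "x \<in> \<Omega> \<Longrightarrow> F \<in> borel_measurable borel \<Longrightarrow> F \<in> borel_measurable (\<nu> x)"
  using sets_young[of x] measurable_cong_sets by blast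

lemma integral_young_measurable:
  fixes F :: "real \<Rightarrow> real"
  assumes "F \<in> borel_measurable borel"
  shows "(\<lambda>x. LINT t|\<nu> x. F t) \<in> borel_measurable (lebesgue_on \<Omega>)"
  using measurable_compose[OF measurable_prob_algebraD integral_measurable_subprob_algebra[OF assms]]
    young unfolding young_measure_def by blast

lemma integral_young_bounds:
  fixes F :: "real \<Rightarrow> real"
  assumes "x \<in> \<Omega>" and F: "F \<in> borel_measurable borel" "\<And>t. a \<le> F t" "\<And>t. F t \<le> b"
  shows "a \<le> (LINT t|\<nu> x. F t)" "(LINT t|\<nu> x. F t) \<le> b" "integrable (\<nu> x) F"
proof -
  interpret prob_space "\<nu> x" by (rule young_prob_space[OF assms(1)])
  have "norm (F t) \<le> max \<bar>a\<bar> \<bar>b\<bar>" for t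
    using F(2,3)[of t] by auto
  then show int: "integrable (\<nu> x) F"
    using young_borel_measurable[OF assms(1) F(1)]
    by (intro integrable_const_bound[of _ "max \<bar>a\<bar> \<bar>b\<bar>"]) auto
  show "a \<le> (LINT t|\<nu> x. F t)" using int F(2) by (intro integral_ge_const) auto
  show "(LINT t|\<nu> x. F t) \<le> b" using int F(3) by (intro integral_le_const) auto
qed

text \<open>Comparing \<open>tail r\<close> with the zero function makes its integral against
  \<open>\<nu> x\<close> orthogonal to \<open>C0c \<Omega>\<close>, hence zero for a.e.
  \<open>x\<close>. Nonnegativity then gives \<open>tail r = 0\<close> almost everywhere for
  \<open>\<nu> x\<close>.\<close>

lemma young_bounded_support:
  assumes eq: "\<And>F G \<phi>. F \<in> C0b \<Longrightarrow> G \<in> C0b \<Longrightarrow> \<phi> \<in> C0c \<Omega> \<Longrightarrow> (\<And>t. \<bar>t\<bar> \<le> r \<Longrightarrow> F t = G t) \<Longrightarrow>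
      (LINT x|lebesgue_on \<Omega>. (LINT t|\<nu> x. F t) * \<phi> x) = (LINT x|lebesgue_on \<Omega>. (LINT t|\<nu> x. G t) * \<phi> x)"
  shows "AE x in lebesgue_on \<Omega>. AE t in \<nu> x. \<bar>t\<bar> \<le> r"
proof -
  let ?g = "\<lambda>x. LINT t|\<nu> x. tail r t"
  note tail = C0b_borel_measurable[OF tail_C0b] tail_bounds(1,3)
  have "AE x in lebesgue_on \<Omega>. ?g x = 0"
  proof (rule AE_zero_if_orthogonal_C0c[OF open_\<Omega>])
    show "?g \<in> borel_measurable (lebesgue_on \<Omega>)"
      by (rule integral_young_measurable[OF tail(1)])
    show "0 \<le> ?g x" "?g x \<le> 1" if "x \<in> \<Omega>" for x
      using integral_young_bounds[OF that tail] by auto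
    show "(LINT x|lebesgue_on \<Omega>. ?g x * \<phi> x) = 0" if "\<phi> \<in> C0c \<Omega>" for \<phi>
      using eq[OF tail_C0b zero_C0b that, of r] by (simp add: tail_eq_0_iff)
  qed
  then show ?thesis
    using AE_space
  proof eventually_elim
    case (elim x)
    then have x: "x \<in> \<Omega>" by (simp add: space_restrict_space)
    have "AE t in \<nu> x. tail r t = 0"
      using elim(1) integral_young_bounds(3)[OF x tail] tail(2)
      by (subst (asm) integral_nonneg_eq_0_iff_AE) auto
    then show ?case by (simp add: tail_eq_0_iff)
  qed
qed

text \<open>\<open>cutoff R\<close> is the identity almost everywhere for \<open>\<nu> x\<close>.
  Letting \<open>R\<close> exceed \<open>r\<close> leaves room for sequences whose bound is larger
  than the radius of the support.\<close>

lemma young_barycenter: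
  assumes "AE x in lebesgue_on \<Omega>. AE t in \<nu> x. \<bar>t\<bar> \<le> r" "r \<le> R" "0 \<le> R"
  shows "AE x in lebesgue_on \<Omega>. integrable (\<nu> x) (\<lambda>t. t) \<and> (LINT t|\<nu> x. t) = (LINT t|\<nu> x. cutoff R t)"
  using assms(1) AE_space
proof eventually_elim
  case (elim x)
  then have x: "x \<in> \<Omega>" by (simp add: space_restrict_space)
  note c = C0b_borel_measurable[OF cutoff_C0b[OF \<open>0 \<le> R\<close>]]
  note m = young_borel_measurable[OF x c] young_borel_measurable[OF x measurable_ident_sets[OF refl]]
  have "- R \<le> cutoff R t" "cutoff R t \<le> R" for t
    using abs_cutoff_le[OF \<open>0 \<le> R\<close>, of t] by auto
  then have int: "integrable (\<nu> x) (cutoff R)"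
    using integral_young_bounds(3)[OF x c] by blast
  have ae: "AE t in \<nu> x. cutoff R t = t"
    using elim(1) by eventually_elim (use \<open>r \<le> R\<close> in \<open>simp add: cutoff_eq\<close>)
  have "integrable (\<nu> x) (\<lambda>t. t)"
    using integrable_cong_AE[OF m ae] int by simp
  moreover have "(LINT t|\<nu> x. t) = (LINT t|\<nu> x. cutoff R t)"
    using integral_cong_AE[OF m ae] by simp
  ultimately show ?case by simp
qed

text \<open>The identity is not in \<open>C0b\<close>, but \<open>cutoff R\<close> is, and it agrees
  with the identity a.e. on the values of each \<open>fs n\<close> and on the carrier of almost
  every \<open>\<nu> x\<close>.\<close>

lemma weakly_star_barycenter:
  assumes supp: "AE x in lebesgue_on \<Omega>. AE t in \<nu> x. \<bar>t\<bar> \<le> r"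
    and h: "h \<in> borel_measurable (lebesgue_on \<Omega>)" "AE x in lebesgue_on \<Omega>. h x = (LINT t|\<nu> x. t)"
    and fs: "\<And>n. fs n \<in> Linf \<Omega>" "\<And>n. AE x in lebesgue_on \<Omega>. \<bar>fs n x\<bar> \<le> C"
    and conv: "weakly_star_to_young \<Omega> fs \<nu>"
  shows "weakly_star_Linf \<Omega> fs h"
  unfolding weakly_star_Linf_def
proof (intro allI impI)
  fix \<phi> :: "real^'k \<Rightarrow> real" assume \<phi>: "integrable (lebesgue_on \<Omega>) \<phi>"
  let ?M = "lebesgue_on \<Omega>"
  \<comment> \<open>Dominates both the support radius and the uniform bound of the sequence.\<close>
  define R where "R = max 0 (max r C)"
  have R: "r \<le> R" "0 \<le> R" "C \<le> R" by (auto simp: R_def)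
  note c[measurable] = C0b_borel_measurable[OF cutoff_C0b[OF \<open>0 \<le> R\<close>]]
  note integral_young_measurable[OF c, measurable] h(1)[measurable]
  have [measurable]: "\<phi> \<in> borel_measurable ?M" using \<phi> by auto
  have [measurable]: "fs n \<in> borel_measurable ?M" for n using fs(1)[of n] by (simp add: Linf_def)
  have "(LINT x|?M. cutoff R (fs n x) * \<phi> x) = (LINT x|?M. fs n x * \<phi> x)" for n
    by (rule integral_cong_AE, measurable)
      (use fs(2)[of n] R in \<open>auto elim!: eventually_mono simp: cutoff_eq\<close>)
  moreover have "(LINT x|?M. (LINT t|\<nu> x. cutoff R t) * \<phi> x) = (LINT x|?M. h x * \<phi> x)"
  proof (rule integral_cong_AE)
    show "AE x in ?M. (LINT t|\<nu> x. cutoff R t) * \<phi> x = h x * \<phi> x"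
      using young_barycenter[OF supp R(1,2)] h(2) by eventually_elim simp
  qed measurable
  moreover have "(\<lambda>n. LINT x|?M. cutoff R (fs n x) * \<phi> x) \<longlonglongrightarrow> (LINT x|?M. (LINT t|\<nu> x. cutoff R t) * \<phi> x)"
    using conv cutoff_C0b[OF R(2)] \<phi> unfolding weakly_star_to_young_def by blast
  ultimately show "(\<lambda>n. LINT x|?M. fs n x * \<phi> x) \<longlonglongrightarrow> (LINT x|?M. h x * \<phi> x)"
    by simp
qed

end

section \<open>The density of the distribution and its consequences\<close>

lemma test_functions_subset_C0c: "test_functions \<Omega> \<subseteq> C0c \<Omega>"
proof
  fix \<phi> assume \<phi>: "\<phi> \<in> test_functions \<Omega>"
  then have "C_k 0 \<phi>" unfolding test_functions_def by blast
  then have "continuous_on UNIV \<phi>" by simp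
  with \<phi> show "\<phi> \<in> C0c \<Omega>" by (simp add: test_functions_def C0c_def)
qed

theorem theorem4p13:
  fixes star :: "('k::finite, 'e) univ list set \<Rightarrow> 'w list set"
    and \<Omega> :: "(real^'k) set"
    and N0 :: 'w
    and f :: "'w \<Rightarrow> 'w"
    and \<nu> :: "real^'k \<Rightarrow> real measure"
  assumes "nonstandard_extension star"
    and "open \<Omega>"
    and "saturated (distributions \<Omega>) star"
    and "infinite_hypnat star N0"
    and "f \<in> grid_functions star N0 \<Omega>"
    and "hfinite star (grid_norm_inf star N0 \<Omega> f)"
    and "is_grid_young_measure star N0 \<Omega> f \<nu>"
  shows "\<exists>h. grid_distr_is star N0 \<Omega> f h \<and>
    (AE x in lebesgue_on \<Omega>. integrable (\<nu> x) (\<lambda>t. t) \<and> h x = (LINT t|\<nu> x. t)) \<and>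
    (\<forall>fs :: nat \<Rightarrow> real^'k \<Rightarrow> real.
       (\<forall>n. fs n \<in> Linf \<Omega>) \<and>
       (\<exists>C. \<forall>n. AE x in lebesgue_on \<Omega>. \<bar>fs n x\<bar> \<le> C) \<and>
       weakly_star_to_young \<Omega> fs \<nu> \<longrightarrow>
       weakly_star_Linf \<Omega> fs h) \<and>
    (dirac_young_measure \<Omega> \<nu> \<longrightarrow> (AE x in lebesgue_on \<Omega>. \<nu> x = return borel (h x)))"
proof -
  have N0: "N0 \<in> hypnat star" using assms(4) by (simp add: infinite_hypnat_def)
  have young: "young_measure \<Omega> \<nu>"
    and std: "\<And>F \<phi>. F \<in> C0b \<Longrightarrow> \<phi> \<in> C0c \<Omega> \<Longrightarrow>
      has_std_part star (grid_inner star N0 \<Omega> (\<lambda>x. hfun star F (f x)) (star_fun star Pt Re \<phi>))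
        (LINT x|lebesgue_on \<Omega>. (LINT t|\<nu> x. F t) * \<phi> x)"
    using assms(7) by (auto simp: is_grid_young_measure_def)
  obtain r where r: "r \<ge> 0"
    "\<And>F G \<phi>. (\<And>t. \<bar>t\<bar> \<le> r \<Longrightarrow> F t = G t) \<Longrightarrow>
      grid_inner star N0 \<Omega> (\<lambda>x. hfun star F (f x)) \<phi> = grid_inner star N0 \<Omega> (\<lambda>x. hfun star G (f x)) \<phi>"
    "\<And>F \<phi>. (\<And>t. \<bar>t\<bar> \<le> r \<Longrightarrow> F t = t) \<Longrightarrow>
      grid_inner star N0 \<Omega> (\<lambda>x. hfun star F (f x)) \<phi> = grid_inner star N0 \<Omega> f \<phi>"
    using grid_inner_hfun_cong[OF assms(1) N0 assms(5,6)] by metis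
  have supp: "AE x in lebesgue_on \<Omega>. AE t in \<nu> x. \<bar>t\<bar> \<le> r"
  proof (rule young_bounded_support[OF assms(2) young])
    fix F G \<phi> assume F: "F \<in> C0b" and G: "G \<in> C0b" and \<phi>: "\<phi> \<in> C0c \<Omega>"
      and eq: "\<And>t. \<bar>t\<bar> \<le> r \<Longrightarrow> F t = G t"
    show "(LINT x|lebesgue_on \<Omega>. (LINT t|\<nu> x. F t) * \<phi> x) = (LINT x|lebesgue_on \<Omega>. (LINT t|\<nu> x. G t) * \<phi> x)"
      \<comment> \<open>Both integrals are standard parts of the same inner product, because
        \<open>F\<close> and \<open>G\<close> agree on the range of \<open>f\<close>.\<close>
      using std_part_unique[OF assms(1) std[OF F \<phi>]] std[OF G \<phi>] r(2)[of F G, OF eq] by simp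
  qed
  \<comment> \<open>Truncating makes \<open>h\<close> measurable and bounded by \<open>r\<close> at
    every point of \<open>\<Omega>\<close>, whereas the barycentre formula is available only almost
    everywhere.\<close>
  define h where "h x = (LINT t|\<nu> x. cutoff r t)" for x
  note cut = cutoff_C0b[OF r(1)] C0b_borel_measurable[OF cutoff_C0b[OF r(1)]]
  have h_meas: "h \<in> borel_measurable (lebesgue_on \<Omega>)"
    unfolding h_def by (rule integral_young_measurable[OF assms(2) young cut(2)])
  have "\<bar>h x\<bar> \<le> r" if "x \<in> \<Omega>" for x
  proof -
    have "- r \<le> cutoff r t" "cutoff r t \<le> r" for t
      using abs_cutoff_le[OF r(1), of t] by auto
    then show ?thesis
      using integral_young_bounds(1,2)[OF assms(2) young that cut(2), of "- r" r] by (simp add: h_def abs_le_iff)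
  qed
  then have "AE x in lebesgue_on \<Omega>. \<bar>h x\<bar> \<le> r"
    by (intro AE_I2) (simp add: space_restrict_space)
  then have h_Linf: "h \<in> Linf \<Omega>" using h_meas by (auto simp: Linf_def)
  have distr: "grid_distr_is star N0 \<Omega> f h"
    unfolding grid_distr_is_def
  proof (intro conjI ballI h_Linf)
    fix \<phi> :: "real^'k \<Rightarrow> real" assume "\<phi> \<in> test_functions \<Omega>"
    then show "has_std_part star (grid_inner star N0 \<Omega> f (star_fun star Pt Re \<phi>))
        (LINT x|lebesgue_on \<Omega>. h x * \<phi> x)"
      \<comment> \<open>On the grid the extension of \<open>cutoff r\<close> leaves the values of
        \<open>f\<close> unchanged, so the representation for \<open>cutoff r\<close> is one for
        \<open>f\<close> itself.\<close>
      using std[OF cut(1), of \<phi>] test_functions_subset_C0c[of \<Omega>] r(3)[of "cutoff r", OF cutoff_eq]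
      by (auto simp: h_def)
  qed
  have bary: "AE x in lebesgue_on \<Omega>. integrable (\<nu> x) (\<lambda>t. t) \<and> h x = (LINT t|\<nu> x. t)"
    using young_barycenter[OF assms(2) young supp order.refl r(1)] by (auto simp: h_def)
  have "weakly_star_Linf \<Omega> fs h"
    if "\<forall>n. fs n \<in> Linf \<Omega>" "\<forall>n. AE x in lebesgue_on \<Omega>. \<bar>fs n x\<bar> \<le> C" "weakly_star_to_young \<Omega> fs \<nu>"
    for fs C
  proof (rule weakly_star_barycenter[OF assms(2) young supp h_meas _ _ _ that(3)])
    show "AE x in lebesgue_on \<Omega>. h x = (LINT t|\<nu> x. t)" using bary by eventually_elim simp
  qed (use that in auto)
  moreover have "AE x in lebesgue_on \<Omega>. \<nu> x = return borel (h x)" if dirac: "dirac_young_measure \<Omega> \<nu>"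
    using bary AE_space
  proof eventually_elim
    case (elim x)
    then obtain y where "\<nu> x = return borel y"
      using dirac by (auto simp: dirac_young_measure_def space_restrict_space)
    \<comment> \<open>The barycentre of the Dirac measure at \<open>y\<close> is \<open>y\<close>,
      which identifies \<open>y\<close> with \<open>h x\<close>.\<close>
    then show ?case using elim(1) by (simp add: integral_return)
  qed
  ultimately show ?thesis using distr bary by blast
qed

end
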